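(* Consider the problem $\min_{\mathbf{x}\in\mathcal{X}}\max_{S\in\mathcal{I}}f(\mathbf{x},S)$, where $\mathcal{X}\subset\mathbb{R}^d$ is convex and bounded, $\mathcal{I}$ is a matroid on $V$, and $f:\mathbb{R}^d\times2^V\to\mathbb{R}_+$ is convex in $\mathbf{x}$ and monotone submodular in $S$. Suppose that: (1) there is $L$ such that $\|\nabla_{\mathbf{x}}f(\mathbf{x},S)-\nabla_{\mathbf{x}}f(\mathbf{x}',S)\|\le L\|\mathbf{x}-\mathbf{x}'\|$ for all $\mathbf{x},\mathbf{x}'\in\mathbb{R}^d$ and all $S\in\mathcal{I}$; (2) there is $M$ such that $\|\nabla_{\mathbf{x}}f(\mathbf{x},S)\|\le M$ for all $\mathbf{x}\in\mathbb{R}^d$ and $S\in2^V$. Then the output $\mathbf{x}_{sol}$ of the Extra-Gradient on Continuous Extension (EGCE) algorithm after $\mathcal{O}(1/\epsilon)$ iterations with constant step size is a $(1/2,\epsilon)$-approximate minimax solution, i.e. $$\tfrac12\max_{S\in\mathcal{I}}f(\mathbf{x}_{sol},S)\le \min_{\mathbf{x}\in\mathcal{X}}\max_{S\in\mathcal{I}}f(\mathbf{x},S)+\epsilon .$$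
   Context: $V$ is a finite ground set with $n$ elements. A set function $g:2^V\to\mathbb{R}$ is submodular if $g(A\cap B)+g(A\cup B)\le g(A)+g(B)$ for all $A,B\subseteq V$, and monotone if $g(A)\le g(B)$ whenever $A\subseteq B$. A nonempty family $\mathcal{I}$ of subsets of $V$ is a matroid if (i) $A\subset B\subset V$ and $B\in\mathcal{I}$ imply $A\in\mathcal{I}$, and (ii) for all $A,B\in\mathcal{I}$ with $|A|<|B|$ there is $e\in B\setminus A$ with $A\cup\{e\}\in\mathcal{I}$. Let $\mathcal{K}=\mathrm{conv}\{1_S:S\in\mathcal{I}\}\subset[0,1]^n$, where $1_S$ is the indicator vector of $S$. The continuous (multilinear) extension of $f$ is $F:\mathbb{R}^d\times[0,1]^n\to\mathbb{R}_+$, $F(\mathbf{x},\mathbf{y})=\mathbb{E}_{S\sim\mathbf{y}}[f(\mathbf{x},S)]$, where $S\sim\mathbf{y}$ is the random set in which each element $i$ is included independently with probability $y_i$. $\pi_{\mathcal{X}},\pi_{\mathcal{K}}$ denote Euclidean projections onto $\mathcal{X}$ (assumed well defined) and $\mathcal{K}$. Extra-Gradient on Continuous Extension (EGCE): initialize $\mathbf{x}_1=\mathbf{0}$, $\mathbf{y}_1=\mathbf{0}$. For $t=1,\dots,T$: $\hat{\mathbf{x}}_t=\pi_{\mathcal{X}}(\mathbf{x}_t-\gamma_t\nabla_{\mathbf{x}}F(\mathbf{x}_t,\mathbf{y}_t))$, $\hat{\mathbf{y}}_t=\pi_{\mathcal{K}}(\mathbf{y}_t+\gamma_t\nabla_{\mathbf{y}}F(\mathbf{x}_t,\mathbf{y}_t))$,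 $\mathbf{x}_{t+1}=\pi_{\mathcal{X}}(\mathbf{x}_t-\gamma_t\nabla_{\mathbf{x}}F(\hat{\mathbf{x}}_t,\hat{\mathbf{y}}_t))$, $\mathbf{y}_{t+1}=\pi_{\mathcal{K}}(\mathbf{y}_t+\gamma_t\nabla_{\mathbf{y}}F(\hat{\mathbf{x}}_t,\hat{\mathbf{y}}_t))$, where $\gamma_t>0$ are step sizes. Output $\mathbf{x}_{sol}=\big(\sum_{t=1}^T\gamma_t\big)^{-1}\sum_{t=1}^T\gamma_t\hat{\mathbf{x}}_t$. Meaning of the asymptotic statement: there are a constant step size $\gamma_t=\gamma>0$ and a constant $C$, both independent of $\epsilon$ (they may depend on $f,\mathcal{X},\mathcal{I}$ and the constants in the hypotheses), such that for all sufficiently small $\epsilon>0$ the conclusion holds for a suitable number of iterations $T\le C/\epsilon$. *)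

theory Defs
  imports "HOL-Analysis.Analysis" "HOL-Probability.Product_PMF"
begin

text \<open>The finite ground set is the universe of a finite type \<open>'v\<close>, so that its power set is
  the type \<open>'v set\<close> and vectors indexed by the ground set have type \<open>real ^ 'v\<close>.\<close>

definition submodular :: "('v set \<Rightarrow> real) \<Rightarrow> bool" where
  "submodular g \<longleftrightarrow> (\<forall>A B. g (A \<inter> B) + g (A \<union> B) \<le> g A + g B)"

definition matroid :: "'v::finite set set \<Rightarrow> bool" where
  "matroid I \<longleftrightarrow>
     I \<noteq> {} \<and>
     (\<forall>A B. A \<subset> B \<longrightarrow> B \<in> I \<longrightarrow> A \<in> I) \<and>
     (\<forall>A\<in>I. \<forall>B\<in>I. card A < card B \<longrightarrow> (\<exists>e\<in>B - A. A \<union> {e} \<in> I))"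

definition matroid_polytope :: "'v::finite set set \<Rightarrow> (real ^ 'v) set" where
  "matroid_polytope I = convex hull ((\<lambda>S. \<chi> i. indicator S i) ` I)"

text \<open>The gradient is only meaningful where \<open>f\<close> is differentiable within \<open>A\<close> and the
  derivative within \<open>A\<close> is unique. It is used for \<open>A = UNIV\<close> (the ordinary gradient) and for
  \<open>A = cbox 0 1\<close>, where uniqueness also holds at boundary points.\<close>

definition gradient_within :: "('a::euclidean_space \<Rightarrow> real) \<Rightarrow> 'a set \<Rightarrow> 'a \<Rightarrow> 'a" where
  "gradient_within f A x = (THE D. (f has_derivative (\<lambda>h. D \<bullet> h)) (at x within A))"

abbreviation gradient :: "('a::euclidean_space \<Rightarrow> real) \<Rightarrow> 'a \<Rightarrow> 'a" where
  "gradient f \<equiv> gradient_within f UNIV"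

lemma gradient_within_cube_eqI:
  fixes F :: "real ^ 'v \<Rightarrow> real"
  assumes "(F has_derivative (\<lambda>h. D \<bullet> h)) (at y within cbox 0 1)" and "y \<in> cbox 0 1"
  shows "gradient_within F (cbox 0 1) y = D"
  unfolding gradient_within_def
proof (rule the_equality)
  fix E assume "(F has_derivative (\<lambda>h. E \<bullet> h)) (at y within cbox 0 1)"
  then have "(\<lambda>h. E \<bullet> h) = (\<lambda>h. D \<bullet> h)"
    using assms(1)
    by (intro frechet_derivative_unique_within_closed_interval[of 0 1 y F])
       (auto simp: Basis_vec_def inner_axis assms(2))
  then have "E \<bullet> h = D \<bullet> h" for h
    by (rule fun_cong)
  then show "E = D"
    using vector_eq_rdot by blast
qed (use assms in auto)

text \<open>The parameters of the Bernoulli distributions are probabilities only for \<open>y\<close> in the unit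
  cube \<open>cbox 0 1\<close>; the extension is a function on that cube, and values outside carry no
  meaning. This is why its gradient in \<open>y\<close> is taken within the cube.\<close>

definition random_subset :: "real ^ 'v::finite \<Rightarrow> 'v set pmf" where
  "random_subset y = map_pmf Collect (Pi_pmf UNIV False (\<lambda>i. bernoulli_pmf (y $ i)))"

definition multilinear_ext :: "('x \<Rightarrow> 'v::finite set \<Rightarrow> real) \<Rightarrow> 'x \<Rightarrow> real ^ 'v \<Rightarrow> real" where
  "multilinear_ext f x y = measure_pmf.expectation (random_subset y) (f x)"

lemma pmf_random_subset:
  assumes "y \<in> cbox 0 1"
  shows "pmf (random_subset y) S = (\<Prod>i\<in>S. y $ i) * (\<Prod>i\<in>-S. 1 - y $ i)"
proof -
  have y: "0 \<le> y $ i" "y $ i \<le> 1" for i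
    using assms by (auto simp: mem_box_cart)
  have "inj (Collect :: ('a \<Rightarrow> bool) \<Rightarrow> 'a set)"
    by (auto intro!: injI)
  then have "pmf (random_subset y) S = pmf (Pi_pmf UNIV False (\<lambda>i. bernoulli_pmf (y $ i))) (\<lambda>i. i \<in> S)"
    unfolding random_subset_def
    by (metis (no_types) pmf_map_inj' Collect_mem_eq)
  also have "\<dots> = (\<Prod>i\<in>UNIV. if i \<in> S then y $ i else 1 - y $ i)"
    using y by (subst pmf_Pi') (auto intro!: prod.cong)
  also have "\<dots> = (\<Prod>i\<in>S. y $ i) * (\<Prod>i\<in>-S. 1 - y $ i)"
    by (subst prod.If_cases) (auto simp: Collect_neg_eq[symmetric])
  finally show ?thesis .
qed

lemma multilinear_ext_eq:
  assumes "y \<in> cbox 0 1"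
  shows "multilinear_ext f x y =
           (\<Sum>S\<in>UNIV. f x S * ((\<Prod>i\<in>S. y $ i) * (\<Prod>i\<in>-S. 1 - y $ i)))"
proof -
  have "multilinear_ext f x y = (\<Sum>S\<in>UNIV. pmf (random_subset y) S *\<^sub>R f x S)"
    unfolding multilinear_ext_def by (rule integral_measure_pmf) auto
  then show ?thesis
    by (simp only: pmf_random_subset[OF assms] real_scaleR_def mult.commute[of _ "f x _"])
qed

lemma differentiable_prod_component:
  fixes y :: "real ^ 'v"
  shows "(\<lambda>y. (\<Prod>i\<in>S. y $ i) * (\<Prod>i\<in>-S. 1 - y $ i)) differentiable (at y within A)"
proof -
  have c: "((\<lambda>y::real^'v. y $ i) has_derivative (\<lambda>h. h $ i)) (at y within A)" for i
    by (rule bounded_linear_imp_has_derivative) (rule bounded_linear_vec_nth)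
  have c': "((\<lambda>y::real^'v. 1 - y $ i) has_derivative (\<lambda>h. 0 - h $ i)) (at y within A)" for i
    by (rule has_derivative_diff[OF has_derivative_const c])
  show ?thesis
    by (rule differentiableI, rule has_derivative_mult, rule has_derivative_prod, rule c,
        rule has_derivative_prod, rule c')
qed

text \<open>Hence the gradient of the extension in \<open>y\<close> is well defined on the whole cube.\<close>

lemma multilinear_ext_has_gradient:
  fixes y :: "real ^ 'v"
  assumes "y \<in> cbox 0 1"
  shows "(multilinear_ext f x has_derivative
            (\<lambda>h. gradient_within (multilinear_ext f x) (cbox 0 1) y \<bullet> h)) (at y within cbox 0 1)"
proof -
  define D where "D S = frechet_derivative
      (\<lambda>y::real^'v. (\<Prod>i\<in>S. y $ i) * (\<Prod>i\<in>-S. 1 - y $ i)) (at y within cbox 0 1)" for S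
  have "((\<lambda>y::real^'v. (\<Prod>i\<in>S. y $ i) * (\<Prod>i\<in>-S. 1 - y $ i)) has_derivative D S)
      (at y within cbox 0 1)" for S
    unfolding D_def
    by (rule iffD1[OF frechet_derivative_works differentiable_prod_component])
  then have "((\<lambda>y. \<Sum>S\<in>UNIV. f x S * ((\<Prod>i\<in>S. y $ i) * (\<Prod>i\<in>-S. 1 - y $ i)))
      has_derivative (\<lambda>h. \<Sum>S\<in>UNIV. f x S * D S h)) (at y within cbox 0 1)"
    by (intro has_derivative_sum has_derivative_mult_right)
  then have d: "(multilinear_ext f x has_derivative (\<lambda>h. \<Sum>S\<in>UNIV. f x S * D S h))
      (at y within cbox 0 1)"
    by (rule has_derivative_transform[rotated 2]) (use assms multilinear_ext_eq in auto)
  let ?D = "\<lambda>h. \<Sum>S\<in>UNIV. f x S * D S h"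
  have "linear ?D"
    using d has_derivative_linear by blast
  then have "?D = (\<lambda>h. adjoint ?D 1 \<bullet> h)"
    using adjoint_works[of ?D] by (auto simp: inner_commute)
  with d have d': "(multilinear_ext f x has_derivative (\<lambda>h. adjoint ?D 1 \<bullet> h))
      (at y within cbox 0 1)"
    by simp
  show ?thesis
    unfolding gradient_within_cube_eqI[OF d' assms] by (rule d')
qed

text \<open>\<open>egce_update f X I \<gamma> z w\<close> is the projected step of size \<open>\<gamma>\<close> taken from \<open>z\<close> along the gradients
  evaluated at \<open>w\<close> (descent in the first, ascent in the second component).\<close>

definition egce_update ::
  "('x::euclidean_space \<Rightarrow> 'v::finite set \<Rightarrow> real) \<Rightarrow> 'x set \<Rightarrow> 'v set set \<Rightarrow> real
     \<Rightarrow> 'x \<times> (real ^ 'v) \<Rightarrow> 'x \<times> (real ^ 'v) \<Rightarrow> 'x \<times> (real ^ 'v)" where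
  "egce_update f X I \<gamma> z w =
     (closest_point X
        (fst z - \<gamma> *\<^sub>R gradient (\<lambda>x. multilinear_ext f x (snd w)) (fst w)),
      closest_point (matroid_polytope I)
        (snd z + \<gamma> *\<^sub>R gradient_within (\<lambda>y. multilinear_ext f (fst w) y) (cbox 0 1) (snd w)))"

definition egce_hat ::
  "('x::euclidean_space \<Rightarrow> 'v::finite set \<Rightarrow> real) \<Rightarrow> 'x set \<Rightarrow> 'v set set \<Rightarrow> real
     \<Rightarrow> 'x \<times> (real ^ 'v) \<Rightarrow> 'x \<times> (real ^ 'v)" where
  "egce_hat f X I \<gamma> z = egce_update f X I \<gamma> z z"

text \<open>Iterates are numbered from 1 in the usual description of the algorithm; here
  \<open>egce_iter f X I \<gamma> t\<close> is the pair \<open>(x\<^sub>t\<^sub>+\<^sub>1, y\<^sub>t\<^sub>+\<^sub>1)\<close> obtained after \<open>t\<close> iterations, and iteration \<open>t\<close>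
  uses the step size \<open>\<gamma> t\<close> for \<open>t \<ge> 1\<close>.\<close>

primrec egce_iter ::
  "('x::euclidean_space \<Rightarrow> 'v::finite set \<Rightarrow> real) \<Rightarrow> 'x set \<Rightarrow> 'v set set \<Rightarrow> (nat \<Rightarrow> real)
     \<Rightarrow> nat \<Rightarrow> 'x \<times> (real ^ 'v)" where
  "egce_iter f X I \<gamma> 0 = (0, 0)"
| "egce_iter f X I \<gamma> (Suc t) =
     egce_update f X I (\<gamma> (Suc t)) (egce_iter f X I \<gamma> t)
       (egce_hat f X I (\<gamma> (Suc t)) (egce_iter f X I \<gamma> t))"

definition egce_output ::
  "('x::euclidean_space \<Rightarrow> 'v::finite set \<Rightarrow> real) \<Rightarrow> 'x set \<Rightarrow> 'v set set \<Rightarrow> (nat \<Rightarrow> real)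
     \<Rightarrow> nat \<Rightarrow> 'x" where
  "egce_output f X I \<gamma> T =
     inverse (\<Sum>t=1..T. \<gamma> t) *\<^sub>R
       (\<Sum>t=1..T. \<gamma> t *\<^sub>R fst (egce_hat f X I (\<gamma> t) (egce_iter f X I \<gamma> (t - 1))))"

text \<open>For compact nonempty \<open>X\<close> and \<open>f\<close> continuous in its first argument the infimum is a minimum.\<close>

definition approx_minimax ::
  "real \<Rightarrow> real \<Rightarrow> ('x \<Rightarrow> 'v::finite set \<Rightarrow> real) \<Rightarrow> 'x set \<Rightarrow> 'v set set \<Rightarrow> 'x \<Rightarrow> bool" where
  "approx_minimax \<alpha> \<epsilon> f X I x' \<longleftrightarrow>
     \<alpha> * (MAX S\<in>I. f x' S) \<le> (INF x\<in>X. MAX S\<in>I. f x S) + \<epsilon>"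

end

theory Submission
  imports Defs
begin

text \<open>
  Write \<open>F\<close> for the multilinear extension, \<open>(xh, yh)\<close> for an extrapolated point of the algorithm and
  \<open>(x, y)\<close> for the iterate before it. For every independent \<open>S\<close>, submodularity and monotonicity give
  \<open>f xh S / 2 \<le> F xh yh + (\<nabla>\<^sub>y F \<bullet> (1\<^sub>S - yh)) / 2\<close>, and convexity gives
  \<open>F xh yh \<le> F u yh + \<nabla>\<^sub>x F \<bullet> (xh - u)\<close> for all \<open>u\<close> in \<open>X\<close>. Moreover \<open>F u yh\<close> is at most the maximum of
  \<open>f u\<close> over the independent sets, by a swap rounding argument that rests on symmetric exchange of
  bases (\<open>subset_mean_le_Max\<close>). So the error of the averaged points is bounded by the regret in \<open>x\<close>
  plus half the regret in \<open>y\<close>, and an extragradient step bounds both by a telescoping energy as long as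
  the change of the gradients between \<open>(x, y)\<close> and \<open>(xh, yh)\<close> is controlled by the length of
  the step.

  The difficulty is that \<open>\<nabla>\<^sub>x F\<close> is an average of gradients of \<open>f \<cdot> R\<close> over sets \<open>R\<close> that may be
  dependent, and for those no Lipschitz condition is assumed. Two observations resolve it.
  First, the inequality of submodularity above has a slack: the expected difference between
  \<open>f xh R\<close> and the sum of the marginal values of the elements of \<open>R\<close> at \<open>R\<close>
  (\<open>subset_mean_first_order_bound\<close>). This slack dominates, up to a constant, the expected gap
  between \<open>f xh R\<close> and its additive upper bound \<open>f xh {} + (\<Sum>i\<in>R. f xh {i})\<close>
  (\<open>additive_gap_le_deficit\<close>). Second, that upper bound has a Lipschitz gradient, because empty set and
  non-loop singletons are independent, and a convex function below a function with Lipschitz gradient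
  can change its gradient only in proportion to the step length and the square root of the gap
  (\<open>gradient_diff_below_smooth\<close>). Hence the squared change of \<open>\<nabla>\<^sub>x F\<close> is at most a constant times the
  squared step length plus the slack. It enters multiplied by \<open>\<gamma>\<^sup>2\<close> while the slack is gained with
  factor \<open>\<gamma>\<close>, so a small constant step size suffices (\<open>egce_energy_decrease\<close>).
\<close>

section \<open>Gradients of convex functions below a smooth function\<close>

lemma has_derivative_gradient:
  fixes h :: "'a::euclidean_space \<Rightarrow> real"
  assumes "h differentiable (at x)"
  shows "(h has_derivative (\<lambda>d. gradient h x \<bullet> d)) (at x)"
proof -
  let ?D = "frechet_derivative h (at x)"
  have d: "(h has_derivative ?D) (at x)"
    using assms frechet_derivative_works by blast
  then have "linear ?D"
    using has_derivative_linear by blast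
  then have "?D = (\<lambda>d. adjoint ?D 1 \<bullet> d)"
    using adjoint_works[of ?D] by (auto simp: inner_commute)
  with d have d': "(h has_derivative (\<lambda>d. adjoint ?D 1 \<bullet> d)) (at x)"
    by simp
  have "E = adjoint ?D 1" if "(h has_derivative (\<lambda>d. E \<bullet> d)) (at x)" for E
    using has_derivative_unique[OF that d'] by (metis vector_eq_rdot)
  then have "gradient h x = adjoint ?D 1"
    unfolding gradient_within_def by (intro the_equality d')
  with d' show ?thesis by simp
qed

lemma gradient_eqI:
  fixes h :: "'a::euclidean_space \<Rightarrow> real"
  assumes "(h has_derivative (\<lambda>d. D \<bullet> d)) (at x)"
  shows "gradient h x = D"
proof -
  have "h differentiable (at x)"
    using assms differentiableI by blast
  from has_derivative_unique[OF has_derivative_gradient[OF this] assms]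
  show ?thesis by (metis vector_eq_rdot)
qed

lemma has_real_derivative_along_line:
  fixes h :: "'a::euclidean_space \<Rightarrow> real"
  assumes "\<And>x. (h has_derivative (\<lambda>d. g x \<bullet> d)) (at x)"
  shows "((\<lambda>t. h (x + t *\<^sub>R d)) has_real_derivative g (x + t *\<^sub>R d) \<bullet> d) (at t)"
proof -
  have "((\<lambda>t. x + t *\<^sub>R d) has_derivative (\<lambda>s. s *\<^sub>R d)) (at t)"
    by (auto intro!: derivative_eq_intros)
  from has_derivative_compose[OF this assms]
  show ?thesis
    unfolding has_field_derivative_def by (simp add: mult.commute[of _ "g _ \<bullet> _"] cong: if_cong)
qed

lemma convex_on_above_tangent:
  fixes h :: "'a::euclidean_space \<Rightarrow> real"
  assumes "convex_on UNIV h" and "\<And>x. (h has_derivative (\<lambda>d. g x \<bullet> d)) (at x)"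
  shows "h x + g x \<bullet> (z - x) \<le> h z"
proof -
  let ?\<phi> = "\<lambda>t. h (x + t *\<^sub>R (z - x))"
  have "convex_on UNIV ?\<phi>"
  proof (intro convex_onI)
    fix t a b :: real assume "0 < t" "t < 1"
    have "x + ((1 - t) *\<^sub>R a + t *\<^sub>R b) *\<^sub>R (z - x)
        = (1 - t) *\<^sub>R (x + a *\<^sub>R (z - x)) + t *\<^sub>R (x + b *\<^sub>R (z - x))"
      by (simp add: algebra_simps)
    then show "?\<phi> ((1 - t) *\<^sub>R a + t *\<^sub>R b) \<le> (1 - t) * ?\<phi> a + t * ?\<phi> b"
      using convex_onD[OF assms(1), of t] \<open>0 < t\<close> \<open>t < 1\<close> by simp
  qed auto
  moreover have "(?\<phi> has_real_derivative g x \<bullet> (z - x)) (at 0)"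
    using has_real_derivative_along_line[OF assms(2), of x "z - x" 0] by simp
  ultimately have "?\<phi> 1 - ?\<phi> 0 \<ge> (g x \<bullet> (z - x)) * (1 - 0)"
    by (intro convex_on_imp_above_tangent[where A = UNIV]) auto
  then show ?thesis by simp
qed

lemma lipschitz_gradient_quadratic_bound:
  fixes h :: "'a::euclidean_space \<Rightarrow> real"
  assumes "\<And>x. (h has_derivative (\<lambda>d. g x \<bullet> d)) (at x)"
    and "\<And>x x'. norm (g x - g x') \<le> L * norm (x - x')"
  shows "h z \<le> h x + g x \<bullet> (z - x) + L / 2 * (norm (z - x))\<^sup>2"
proof -
  define d where "d = z - x"
  let ?\<psi> = "\<lambda>t. h (x + t *\<^sub>R d) - t * (g x \<bullet> d) - L / 2 * t\<^sup>2 * (norm d)\<^sup>2"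
  have "?\<psi> 1 \<le> ?\<psi> 0"
  proof (rule DERIV_nonpos_imp_nonincreasing[of 0 1 ?\<psi>])
    fix t :: real assume t: "0 \<le> t" "t \<le> 1"
    have "(?\<psi> has_real_derivative (g (x + t *\<^sub>R d) \<bullet> d - g x \<bullet> d - L * t * (norm d)\<^sup>2)) (at t)"
      by (auto intro!: derivative_eq_intros has_real_derivative_along_line[OF assms(1)])
    moreover have "g (x + t *\<^sub>R d) \<bullet> d - g x \<bullet> d \<le> L * t * (norm d)\<^sup>2"
    proof -
      have "(g (x + t *\<^sub>R d) - g x) \<bullet> d \<le> norm (g (x + t *\<^sub>R d) - g x) * norm d"
        by (rule norm_cauchy_schwarz)
      also have "\<dots> \<le> (L * norm (t *\<^sub>R d)) * norm d"
        using assms(2)[of "x + t *\<^sub>R d" x] by (intro mult_right_mono) auto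
      also have "\<dots> = L * t * (norm d)\<^sup>2"
        using t by (simp add: power2_eq_square)
      finally show ?thesis by (simp add: inner_diff_left)
    qed
    ultimately show "\<exists>y. (?\<psi> has_real_derivative y) (at t) \<and> y \<le> 0"
      by (intro exI[of _ "g (x + t *\<^sub>R d) \<bullet> d - g x \<bullet> d - L * t * (norm d)\<^sup>2"]) auto
  qed simp
  then show ?thesis by (simp add: d_def)
qed

text \<open>A convex function \<open>h\<close> need not have a Lipschitz gradient, but if it lies below a function \<open>s\<close>
  with \<open>L\<close>-Lipschitz gradient, then its gradient can jump only where there is room between the
  two: a change of gradient from \<open>z\<close> to \<open>x\<close> is controlled by the distance and by the gap
  \<open>s z - h z\<close> at one of the two points. The gap \<open>e = s - h\<close> is nonnegative and has the quadratic
  upper bounds of \<open>s\<close>, hence \<open>\<parallel>\<nabla>e\<parallel>\<^sup>2 \<le> 2 L e\<close> everywhere, and \<open>e x\<close> is itself bounded by \<open>e z\<close> and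
  the distance.\<close>

lemma gradient_diff_below_smooth:
  fixes h s :: "'a::euclidean_space \<Rightarrow> real"
  assumes "convex_on UNIV h" and dh: "\<And>x. (h has_derivative (\<lambda>d. gh x \<bullet> d)) (at x)"
    and ds: "\<And>x. (s has_derivative (\<lambda>d. gs x \<bullet> d)) (at x)"
    and lip: "\<And>x x'. norm (gs x - gs x') \<le> L * norm (x - x')"
    and "L > 0" and le: "\<And>x. h x \<le> s x"
  shows "(norm (gh x - gh z))\<^sup>2 \<le> 9 * L\<^sup>2 * (norm (x - z))\<^sup>2 + 18 * L * (s z - h z)"
proof -
  define e where "e x = s x - h x" for x
  define p where "p x = gs x - gh x" for x
  have upper: "e z \<le> e x + p x \<bullet> (z - x) + L / 2 * (norm (z - x))\<^sup>2" for x z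
    using convex_on_above_tangent[OF assms(1) dh, of x z]
      lipschitz_gradient_quadratic_bound[OF ds lip, of z x]
    unfolding e_def p_def by (simp add: inner_diff_left)
  have p: "(norm (p x))\<^sup>2 \<le> 2 * L * e x" for x
  proof -
    \<comment> \<open>the minimiser of the quadratic upper bound of \<open>e\<close> around \<open>x\<close>\<close>
    define z where "z = x - inverse L *\<^sub>R p x"
    have "0 \<le> e z" using le by (simp add: e_def)
    also have "\<dots> \<le> e x + p x \<bullet> (z - x) + L / 2 * (norm (z - x))\<^sup>2" by (rule upper)
    also have "\<dots> = e x - (norm (p x))\<^sup>2 / (2 * L)"
      using \<open>L > 0\<close> unfolding z_def power2_norm_eq_inner by (simp add: power2_eq_square field_simps flip: power2_norm_eq_inner)
    finally show ?thesis using \<open>L > 0\<close> by (simp add: field_simps)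
  qed
  define \<delta> where "\<delta> = norm (x - z)"
  have "p z \<bullet> (x - z) \<le> e z + L / 2 * \<delta>\<^sup>2"
  proof -
    have "0 \<le> (norm (p z - L *\<^sub>R (x - z)))\<^sup>2" by simp
    also have "\<dots> = (norm (p z))\<^sup>2 - 2 * L * (p z \<bullet> (x - z)) + L\<^sup>2 * \<delta>\<^sup>2"
      unfolding \<delta>_def power2_norm_eq_inner by (simp add: inner_commute power2_eq_square inner_diff algebra_simps)
    also have "\<dots> \<le> 2 * L * (e z - p z \<bullet> (x - z) + L / 2 * \<delta>\<^sup>2)"
      using p[of z] by (simp add: algebra_simps power2_eq_square)
    finally show ?thesis using \<open>L > 0\<close> by (simp add: zero_le_mult_iff)
  qed
  with upper[of x z] have "e x \<le> 2 * e z + L * \<delta>\<^sup>2"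
    unfolding \<delta>_def by (simp add: algebra_simps)
  then have px: "(norm (p x))\<^sup>2 \<le> 4 * L * e z + 2 * L\<^sup>2 * \<delta>\<^sup>2"
    using p[of x] \<open>L > 0\<close> mult_left_mono[of "e x" "2 * e z + L * \<delta>\<^sup>2" "2 * L"]
    by (simp add: algebra_simps power2_eq_square)
  have three: "(a + b + c)\<^sup>2 \<le> 3 * (a\<^sup>2 + b\<^sup>2 + c\<^sup>2)" for a b c :: real
  proof -
    have "3 * (a\<^sup>2 + b\<^sup>2 + c\<^sup>2) - (a + b + c)\<^sup>2 = (a - b)\<^sup>2 + (b - c)\<^sup>2 + (a - c)\<^sup>2"
      by (simp add: power2_eq_square algebra_simps)
    then show ?thesis
      using zero_le_power2[of "a - b"] zero_le_power2[of "b - c"] zero_le_power2[of "a - c"] by linarith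
  qed
  have "norm (gh x - gh z) = norm ((gs x - gs z) - p x + p z)"
    by (simp add: p_def)
  also have "\<dots> \<le> norm (gs x - gs z) + norm (p x) + norm (p z)"
    using norm_triangle_ineq[of "gs x - gs z - p x" "p z"] norm_triangle_ineq4[of "gs x - gs z" "p x"]
    by linarith
  also have "\<dots> \<le> L * \<delta> + norm (p x) + norm (p z)"
    using lip by (simp add: \<delta>_def)
  finally have "(norm (gh x - gh z))\<^sup>2 \<le> (L * \<delta> + norm (p x) + norm (p z))\<^sup>2"
    by (intro power_mono) auto
  also have "\<dots> \<le> 3 * ((L * \<delta>)\<^sup>2 + (norm (p x))\<^sup>2 + (norm (p z))\<^sup>2)"
    by (rule three)
  also have "\<dots> \<le> 9 * L\<^sup>2 * \<delta>\<^sup>2 + 18 * L * e z"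
    using px p[of z] by (simp add: power_mult_distrib)
  finally show ?thesis by (simp add: \<delta>_def e_def)
qed

section \<open>Expectations over random subsets\<close>

text \<open>The probability that the random subset with inclusion probabilities \<open>y\<close> equals \<open>R\<close>, and the
  expectation of \<open>g\<close> over it. As polynomials in \<open>y\<close> both make sense outside the unit cube too, which
  keeps the algebraic identities below free of side conditions.\<close>

definition subset_weight :: "real ^ 'v::finite \<Rightarrow> 'v set \<Rightarrow> real" where
  "subset_weight y R = (\<Prod>i\<in>UNIV. if i \<in> R then y $ i else 1 - y $ i)"

definition subset_mean :: "real ^ 'v::finite \<Rightarrow> ('v set \<Rightarrow> real) \<Rightarrow> real" where
  "subset_mean y g = (\<Sum>R\<in>UNIV. subset_weight y R * g R)"

text \<open>The marginal value of \<open>i\<close> with respect to the other elements of \<open>R\<close>; it does not depend on whether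
  \<open>i\<close> lies in \<open>R\<close>.\<close>

definition marginal :: "'v \<Rightarrow> ('v set \<Rightarrow> real) \<Rightarrow> 'v set \<Rightarrow> real" where
  "marginal i g R = g (insert i R) - g (R - {i})"

lemma multilinear_ext_eq_subset_mean:
  assumes "y \<in> cbox 0 1"
  shows "multilinear_ext f x y = subset_mean y (f x)"
proof -
  have "(\<Prod>i\<in>S. y $ i) * (\<Prod>i\<in>-S. 1 - y $ i) = subset_weight y S" for S
    unfolding subset_weight_def by (subst prod.If_cases) (auto simp: Collect_neg_eq[symmetric])
  then show ?thesis
    unfolding multilinear_ext_eq[OF assms] subset_mean_def by (simp add: mult.commute)
qed

lemma subset_mean_add: "subset_mean y (\<lambda>R. g R + h R) = subset_mean y g + subset_mean y h"
  by (simp add: subset_mean_def distrib_left sum.distrib)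

lemma subset_mean_diff: "subset_mean y (\<lambda>R. g R - h R) = subset_mean y g - subset_mean y h"
  by (simp add: subset_mean_def right_diff_distrib sum_subtractf)

lemma subset_mean_cmult: "subset_mean y (\<lambda>R. c * g R) = c * subset_mean y g"
  by (simp add: subset_mean_def sum_distrib_left mult.left_commute)

lemma subset_mean_sum: "subset_mean y (\<lambda>R. \<Sum>i\<in>A. g i R) = (\<Sum>i\<in>A. subset_mean y (g i))"
  unfolding subset_mean_def sum_distrib_left by (rule sum.swap)

lemma subset_weight_nonneg: "y \<in> cbox 0 1 \<Longrightarrow> 0 \<le> subset_weight y R"
  unfolding subset_weight_def by (intro prod_nonneg) (auto simp: mem_box_cart)

lemma subset_mean_mono:
  assumes "y \<in> cbox 0 1" and "\<And>R. g R \<le> h R"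
  shows "subset_mean y g \<le> subset_mean y h"
  unfolding subset_mean_def using assms
  by (intro sum_mono mult_left_mono subset_weight_nonneg)

lemma subset_weight_indicator: "subset_weight (\<chi> i. indicator S i) R = (if R = S then 1 else 0)"
proof (cases "R = S")
  case False
  then obtain i where "i \<in> R \<longleftrightarrow> i \<notin> S" by auto
  then have "(if i \<in> R then (\<chi> i. indicator S i) $ i else 1 - (\<chi> i. indicator S i) $ i) = (0::real)"
    by auto
  then have "subset_weight (\<chi> i. indicator S i) R = 0"
    unfolding subset_weight_def by (intro prod_zero bexI[of _ i]) auto
  with False show ?thesis by simp
qed (simp add: subset_weight_def, intro prod.neutral, simp)

lemma subset_mean_indicator: "subset_mean (\<chi> i. indicator S i) g = g S"
  by (simp add: subset_mean_def subset_weight_indicator if_distrib[of "\<lambda>c. c * _"] cong: if_cong)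

lemma subset_weight_eq_0: "i \<in> R \<Longrightarrow> y $ i = 0 \<Longrightarrow> subset_weight y R = 0"
  unfolding subset_weight_def by (auto intro!: bexI[of _ i])

text \<open>Conditioning on whether \<open>i\<close> is chosen: the weights in this sum do not involve \<open>y $ i\<close>, so the
  expectation is affine in that coordinate.\<close>

lemma subset_mean_split:
  fixes y :: "real ^ 'v::finite"
  shows "subset_mean y g = (\<Sum>R | i \<notin> R. (\<Prod>j\<in>UNIV-{i}. if j \<in> R then y $ j else 1 - y $ j) *
           ((1 - y $ i) * g R + y $ i * g (insert i R)))"
proof -
  define A :: "'v set set" where "A = {R. i \<notin> R}"
  define Q where "Q R = (\<Prod>j\<in>UNIV-{i}. if j \<in> R then y $ j else 1 - y $ j)" for R
  have w: "subset_weight y R = (if i \<in> R then y $ i else 1 - y $ i) * Q R" for R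
    unfolding subset_weight_def Q_def by (rule prod.remove) auto
  have Q: "Q (insert i R) = Q R" for R
    unfolding Q_def by (intro prod.cong) auto
  have U: "UNIV = A \<union> insert i ` A"
  proof -
    have "R \<in> insert i ` A" if "i \<in> R" for R
      using that by (intro image_eqI[of _ _ "R - {i}"]) (auto simp: A_def)
    then show ?thesis unfolding A_def by blast
  qed
  have "subset_mean y g = (\<Sum>R\<in>A. subset_weight y R * g R) + (\<Sum>R\<in>insert i ` A. subset_weight y R * g R)"
    unfolding subset_mean_def by (subst U, rule sum.union_disjoint) (auto simp: A_def)
  also have "(\<Sum>R\<in>insert i ` A. subset_weight y R * g R)
      = (\<Sum>R\<in>A. subset_weight y (insert i R) * g (insert i R))"
    by (subst sum.reindex) (auto simp: A_def inj_on_def)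
  finally have "subset_mean y g = (\<Sum>R\<in>A. Q R * ((1 - y $ i) * g R + y $ i * g (insert i R)))"
    unfolding sum.distrib[symmetric]
    by (auto simp: w Q A_def algebra_simps intro!: sum.cong)
  then show ?thesis by (simp add: A_def Q_def)
qed

lemma subset_mean_marginal:
  fixes y :: "real ^ 'v::finite"
  shows "subset_mean y (marginal i g) = (\<Sum>R | i \<notin> R.
           (\<Prod>j\<in>UNIV-{i}. if j \<in> R then y $ j else 1 - y $ j) * (g (insert i R) - g R))"
  unfolding subset_mean_split[of y _ i] marginal_def
  by (intro sum.cong) (auto simp: algebra_simps)

lemma subset_mean_shift:
  fixes y :: "real ^ 'v::finite"
  shows "subset_mean (y + axis i a) g = subset_mean y g + a * subset_mean y (marginal i g)"
proof -
  have "(\<Prod>j\<in>UNIV-{i}. if j \<in> R then (y + axis i a) $ j else 1 - (y + axis i a) $ j)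
      = (\<Prod>j\<in>UNIV-{i}. if j \<in> R then y $ j else 1 - y $ j)" for R
    by (intro prod.cong) (auto simp: axis_def)
  then show ?thesis
    unfolding subset_mean_split[of _ g i] subset_mean_marginal sum_distrib_left sum.distrib[symmetric]
    by (intro sum.cong) (auto simp: algebra_simps axis_def)
qed

lemma subset_mean_const [simp]: "subset_mean y (\<lambda>_. c) = c"
proof -
  have "(\<Prod>i\<in>UNIV. y $ i + (1 - y $ i)) = (\<Sum>R\<in>Pow UNIV. (\<Prod>i\<in>R. y $ i) * (\<Prod>i\<in>UNIV-R. 1 - y $ i))"
    by (rule prod_add) auto
  moreover have "(\<Prod>i\<in>S. y $ i) * (\<Prod>i\<in>UNIV-S. 1 - y $ i) = subset_weight y S" for S
    unfolding subset_weight_def by (subst prod.If_cases) (auto simp: Compl_eq_Diff_UNIV intro!: arg_cong2[where f="(*)"] prod.cong)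
  ultimately show ?thesis by (simp add: subset_mean_def flip: sum_distrib_right)
qed

lemma component_times_mean_marginal:
  "y $ i * subset_mean y (marginal i g) = subset_mean y (\<lambda>R. if i \<in> R then g R - g (R - {i}) else 0)"
  unfolding subset_mean_marginal unfolding subset_mean_split[of y "\<lambda>R. if i \<in> R then g R - g (R - {i}) else 0" i] sum_distrib_left
  by (intro sum.cong) auto

lemma abs_subset_weight_diff:
  assumes "y \<in> cbox 0 1" "y' \<in> cbox 0 (1::real^'v::finite)"
  shows "\<bar>subset_weight y R - subset_weight y' R\<bar> \<le> CARD('v) * norm (y - y')"
proof -
  have "norm (subset_weight y R - subset_weight y' R)
      \<le> (\<Sum>i\<in>UNIV. norm ((if i \<in> R then y $ i else 1 - y $ i) - (if i \<in> R then y' $ i else 1 - y' $ i)))"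
    unfolding subset_weight_def using assms
    by (intro norm_prod_diff) (auto simp: mem_box_cart)
  also have "\<dots> \<le> (\<Sum>i\<in>(UNIV::'v set). norm (y - y'))"
  proof (intro sum_mono)
    fix i :: 'v
    have "\<bar>(y - y') $ i\<bar> \<le> norm (y - y')" by (rule component_le_norm_cart)
    then show "norm ((if i \<in> R then y $ i else 1 - y $ i) - (if i \<in> R then y' $ i else 1 - y' $ i)) \<le> norm (y - y')"
      by auto
  qed
  finally show ?thesis by simp
qed

text \<open>Within the cube, the segment through \<open>y\<close> in direction \<open>i\<close> determines the partial derivative, also at
  boundary points, where only one side of it is available.\<close>

lemma gradient_within_multilinear_ext:
  fixes y :: "real ^ 'v::finite"
  assumes y: "y \<in> cbox 0 1"
  shows "gradient_within (multilinear_ext f x) (cbox 0 1) y = (\<chi> i. subset_mean y (marginal i (f x)))"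
proof -
  let ?D = "gradient_within (multilinear_ext f x) (cbox 0 1) y"
  have "?D $ i = subset_mean y (marginal i (f x))" for i
  proof -
    let ?l = "\<lambda>t. y + axis i (t - y $ i)"
    have yi: "0 \<le> y $ i" "y $ i \<le> 1" using y by (auto simp: mem_box_cart)
    have l: "?l t \<in> cbox 0 1" if "t \<in> {0..1}" for t
      using y that by (auto simp: mem_box_cart axis_def)
    have "(?l has_derivative (\<lambda>t. axis i t)) (at (y $ i) within {0..1})"
    proof -
      have "bounded_linear (axis i :: real \<Rightarrow> real ^ 'v)"
        by (intro linear_conv_bounded_linear[THEN iffD1] linearI) (auto simp: axis_def vec_eq_iff)
      then show ?thesis
        by (auto intro!: derivative_eq_intros bounded_linear.has_derivative[of "axis i"])
    qed
    moreover have "(multilinear_ext f x has_derivative (\<lambda>h. ?D \<bullet> h)) (at (?l (y $ i)) within ?l ` {0..1})"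
    proof (rule has_derivative_subset)
      show "(multilinear_ext f x has_derivative (\<lambda>h. ?D \<bullet> h)) (at (?l (y $ i)) within cbox 0 1)"
        using multilinear_ext_has_gradient[OF y, of f x] by (simp add: axis_def zero_vec_def[symmetric])
    qed (use l in blast)
    ultimately have "((\<lambda>t. multilinear_ext f x (?l t)) has_derivative (\<lambda>t. ?D \<bullet> axis i t)) (at (y $ i) within {0..1})"
      by (rule has_derivative_in_compose)
    then have 1: "((\<lambda>t. multilinear_ext f x (?l t)) has_vector_derivative ?D $ i) (at (y $ i) within {0..1})"
      unfolding has_vector_derivative_def by (simp add: inner_axis mult.commute)
    have "((\<lambda>t. subset_mean y (f x) + (t - y $ i) * subset_mean y (marginal i (f x)))
        has_vector_derivative subset_mean y (marginal i (f x))) (at (y $ i) within {0..1})"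
      by (auto intro!: derivative_eq_intros simp: has_real_derivative_iff_has_vector_derivative[symmetric])
    then have 2: "((\<lambda>t. multilinear_ext f x (?l t)) has_vector_derivative
        subset_mean y (marginal i (f x))) (at (y $ i) within {0..1})"
      by (rule has_vector_derivative_transform[rotated 2])
        (use yi l in \<open>auto simp: multilinear_ext_eq_subset_mean subset_mean_shift\<close>)
    show ?thesis
      using 1 2 yi
      by (intro vector_derivative_unique_within_closed_interval[of 0 1 "y $ i" "\<lambda>t. multilinear_ext f x (?l t)"]) auto
  qed
  then show ?thesis by (simp add: vec_eq_iff)
qed

text \<open>Nonnegativity of the variance.\<close>

lemma subset_mean_square_le:
  assumes "y \<in> cbox 0 1"
  shows "(subset_mean y a)\<^sup>2 \<le> subset_mean y (\<lambda>R. (a R)\<^sup>2)"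
proof -
  define m where "m = subset_mean y a"
  have "subset_mean y (\<lambda>_. 0) \<le> subset_mean y (\<lambda>R. (a R - m)\<^sup>2)"
    by (intro subset_mean_mono assms) simp
  also have "(\<lambda>R. (a R - m)\<^sup>2) = (\<lambda>R. ((a R)\<^sup>2 - 2 * m * a R) + m\<^sup>2)"
    by (simp add: power2_eq_square algebra_simps)
  also have "subset_mean y \<dots> = subset_mean y (\<lambda>R. (a R)\<^sup>2) - m\<^sup>2"
    unfolding subset_mean_add subset_mean_diff subset_mean_cmult by (simp add: m_def power2_eq_square)
  finally show ?thesis by (simp add: m_def)
qed

section \<open>Submodular inequalities\<close>

lemma submodularD: "submodular g \<Longrightarrow> g (A \<inter> B) + g (A \<union> B) \<le> g A + g B"
  by (simp add: submodular_def)

lemma submodular_diminishing_returns: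
  assumes "submodular g" "A \<subseteq> B" "i \<notin> B"
  shows "g (insert i B) - g B \<le> g (insert i A) - g A"
proof -
  have "insert i A \<inter> B = A" "insert i A \<union> B = insert i B"
    using assms(2,3) by auto
  then show ?thesis using submodularD[OF assms(1), of "insert i A" B] by simp
qed

lemma marginal_marginal_nonpos:
  assumes "submodular g" "i \<noteq> j"
  shows "marginal i (marginal j g) R \<le> 0"
proof -
  have "insert j (R - {i}) \<inter> (insert i R - {j}) = R - {i} - {j}"
    "insert j (R - {i}) \<union> (insert i R - {j}) = insert j (insert i R)"
    using assms(2) by auto
  then show ?thesis
    using submodularD[OF assms(1), of "insert j (R - {i})" "insert i R - {j}"]
    by (simp add: marginal_def)
qed

lemma marginal_nonneg: "mono g \<Longrightarrow> 0 \<le> marginal i g R"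
  unfolding marginal_def by (metis diff_ge_0_iff_ge monoD Diff_subset subset_insertI order_trans)

lemma submodular_union_le:
  assumes "submodular g" "finite A"
  shows "g (R \<union> A) \<le> g R + (\<Sum>i\<in>A. g (insert i R) - g R)"
  using assms(2)
proof (induction A)
  case (insert a A)
  have "g (insert a (R \<union> A)) - g (R \<union> A) \<le> g (insert a R) - g R"
  proof (cases "a \<in> R")
    case True
    then have "insert a (R \<union> A) = R \<union> A" "insert a R = R" by auto
    then show ?thesis by simp
  next
    case False
    with insert.hyps show ?thesis
      by (intro submodular_diminishing_returns[OF assms(1)]) auto
  qed
  with insert show ?case by simp
qed simp

text \<open>Removing the elements of \<open>A\<close> one after another loses at least the marginal values that they have
  at the full set \<open>R\<close>.\<close>

lemma sum_last_marginals_le: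
  assumes "submodular g" "finite A" "A \<subseteq> R"
  shows "(\<Sum>i\<in>A. g R - g (R - {i})) \<le> g R - g (R - A)"
  using assms(2,3)
proof (induction A)
  case (insert a A)
  have "g (insert a (R - {a})) - g (R - {a}) \<le> g (insert a (R - insert a A)) - g (R - insert a A)"
    by (rule submodular_diminishing_returns[OF assms(1)]) auto
  moreover have "insert a (R - {a}) = R" "insert a (R - insert a A) = R - A"
    using insert by auto
  ultimately show ?case using insert by simp
qed simp

text \<open>The part of \<open>g R\<close> that is not accounted for by the marginal values of the elements of \<open>R\<close> at
  \<open>R\<close>. It is the slack that appears in the first-order inequality for the multilinear
  extension.\<close>

definition marginal_deficit :: "('v set \<Rightarrow> real) \<Rightarrow> 'v set \<Rightarrow> real" where
  "marginal_deficit g R = g R - (\<Sum>i\<in>R. g R - g (R - {i}))"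

text \<open>The distance of \<open>g R\<close> from its additive upper bound built from \<open>{}\<close> and the singletons. Counting
  \<open>g {}\<close> in full makes the gap nonnegative also for \<open>R = {}\<close>.\<close>

definition additive_gap :: "('v set \<Rightarrow> real) \<Rightarrow> 'v set \<Rightarrow> real" where
  "additive_gap g R = g {} + (\<Sum>i\<in>R. g {i}) - g R"

lemma additive_gap_nonneg:
  assumes "submodular g" "0 \<le> g {}" "finite R"
  shows "0 \<le> additive_gap g R"
proof -
  have "g R \<le> g {} + (\<Sum>i\<in>R. g {i} - g {})"
    using submodular_union_le[OF assms(1,3), of "{}"] by simp
  also have "\<dots> \<le> g {} + (\<Sum>i\<in>R. g {i})"
    using assms(2) by (intro add_left_mono sum_mono) simp
  finally show ?thesis by (simp add: additive_gap_def)
qed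

text \<open>If the marginal values at \<open>R\<close> nearly exhaust \<open>g R\<close>, then \<open>g\<close> is nearly additive below \<open>R\<close>: when
  the elements of \<open>R\<close> are added with \<open>i\<close> first, the later ones contribute at least their marginal values
  at \<open>R\<close>, so \<open>g {i}\<close> exceeds the marginal value of \<open>i\<close> at \<open>R\<close> by at most the deficit.\<close>

lemma additive_gap_le_deficit:
  assumes "submodular g" "finite R"
  shows "additive_gap g R \<le> card R * marginal_deficit g R"
proof -
  let ?s = "marginal_deficit g R"
  have "g {i} \<le> ?s + (g R - g (R - {i}))" if "i \<in> R" for i
  proof -
    have "R - (R - {i}) = {i}" using that by auto
    then have "(\<Sum>j\<in>R - {i}. g R - g (R - {j})) \<le> g R - g {i}"
      using sum_last_marginals_le[OF assms(1), of "R - {i}" R] assms(2) by simp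
    then show ?thesis
      using sum.remove[OF assms(2) that, of "\<lambda>j. g R - g (R - {j})"]
      by (simp add: marginal_deficit_def)
  qed
  then have "(\<Sum>i\<in>R. g {i}) \<le> (\<Sum>i\<in>R. ?s + (g R - g (R - {i})))"
    by (intro sum_mono)
  also have "\<dots> = card R * ?s + (g R - ?s)"
    unfolding sum.distrib by (simp add: marginal_deficit_def)
  finally have 1: "(\<Sum>i\<in>R. g {i}) - g R \<le> card R * ?s - ?s" by simp
  have "g {} \<le> ?s"
    using sum_last_marginals_le[OF assms(1,2) order_refl] by (simp add: marginal_deficit_def)
  with 1 show ?thesis by (simp add: additive_gap_def)
qed

text \<open>The usual form of this inequality, which gives the approximation factor \<open>1/2\<close>, has no deficit on
  the left. Keeping it costs nothing, since the inner product with \<open>y\<close> is the expectation of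
  the sum of the last marginal values.\<close>

lemma subset_mean_first_order_bound:
  fixes y :: "real ^ 'v::finite"
  assumes "submodular g" "mono g" "y \<in> cbox 0 1"
  shows "g S + subset_mean y (marginal_deficit g) \<le>
    2 * subset_mean y g + (\<chi> i. subset_mean y (marginal i g)) \<bullet> ((\<chi> i. indicator S i) - y)"
proof -
  have ptwise: "g S \<le> g R + (\<Sum>i\<in>S. marginal i g R)" for R
  proof -
    have "g S \<le> g (R \<union> S)" using assms(2) by (auto intro: monoD)
    also have "\<dots> \<le> g R + (\<Sum>i\<in>S. g (insert i R) - g R)"
      by (rule submodular_union_le[OF assms(1)]) simp
    also have "\<dots> \<le> g R + (\<Sum>i\<in>S. marginal i g R)"
      unfolding marginal_def using assms(2)
      by (intro add_left_mono sum_mono diff_left_mono) (auto intro: monoD)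
    finally show ?thesis .
  qed
  have "g S = subset_mean y (\<lambda>_. g S)" by simp
  also have "\<dots> \<le> subset_mean y (\<lambda>R. g R + (\<Sum>i\<in>S. marginal i g R))"
    by (rule subset_mean_mono[OF assms(3)]) (rule ptwise)
  also have "\<dots> = subset_mean y g + (\<Sum>i\<in>S. subset_mean y (marginal i g))"
    by (simp add: subset_mean_add subset_mean_sum)
  finally have 1: "g S \<le> subset_mean y g + (\<Sum>i\<in>S. subset_mean y (marginal i g))" .
  have "subset_mean y (marginal_deficit g)
      = subset_mean y g - subset_mean y (\<lambda>R. \<Sum>i\<in>UNIV. if i \<in> R then g R - g (R - {i}) else 0)"
    unfolding marginal_deficit_def subset_mean_diff[symmetric] by (simp add: sum.If_cases)
  also have "\<dots> = subset_mean y g - (\<Sum>i\<in>UNIV. y $ i * subset_mean y (marginal i g))"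
    by (simp add: subset_mean_sum component_times_mean_marginal)
  finally have 2: "subset_mean y (marginal_deficit g)
      = subset_mean y g - (\<Sum>i\<in>UNIV. y $ i * subset_mean y (marginal i g))" .
  have "(\<chi> i. subset_mean y (marginal i g)) \<bullet> ((\<chi> i. indicator S i) - y)
     = (\<Sum>i\<in>UNIV. indicator S i * subset_mean y (marginal i g)) - (\<Sum>i\<in>UNIV. y $ i * subset_mean y (marginal i g))"
    by (simp add: inner_vec_def algebra_simps sum_subtractf)
  also have "(\<Sum>i\<in>UNIV. indicator S i * subset_mean y (marginal i g)) = (\<Sum>i\<in>S. subset_mean y (marginal i g))"
    by simp
  finally show ?thesis using 1 2 by simp
qed

section \<open>Matroids and the matroid polytope\<close>

lemma matroid_subset:
  assumes "matroid I" "B \<in> I" "A \<subseteq> B"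
  shows "A \<in> I"
proof (cases "A = B")
  case False
  with assms(3) have "A \<subset> B" by blast
  with assms(1,2) show ?thesis unfolding matroid_def by blast
qed (use assms in simp)

lemma matroid_augment:
  assumes "matroid I" "A \<in> I" "B \<in> I" "card A < card B"
  obtains e where "e \<in> B" "e \<notin> A" "insert e A \<in> I"
proof -
  obtain e where "e \<in> B - A" "A \<union> {e} \<in> I"
    using assms unfolding matroid_def by blast
  then show thesis by (intro that[of e]) auto
qed

lemma matroid_extend:
  assumes I: "matroid I" and "A \<in> I" "B \<in> I" "card A \<le> card B"
  obtains D where "D \<in> I" "A \<subseteq> D" "D \<subseteq> A \<union> B" "card D = card B"
  using assms(2,4)
proof (induction "card B - card A" arbitrary: A thesis)
  case 0
  then show ?case by (intro "0.prems"(1)[of A]) auto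
next
  case (Suc n)
  then have "card A < card B" by simp
  then obtain e where e: "e \<in> B" "e \<notin> A" "insert e A \<in> I"
    using matroid_augment[OF I Suc.prems(2) \<open>B \<in> I\<close>] by blast
  have "card (insert e A) = Suc (card A)" using e by simp
  with Suc have "n = card B - card (insert e A)" "card (insert e A) \<le> card B"
    using \<open>card A < card B\<close> by auto
  with Suc.hyps(1)[OF this(1) _ e(3)] obtain D where
    "D \<in> I" "insert e A \<subseteq> D" "D \<subseteq> insert e A \<union> B" "card D = card B" by metis
  with e show ?case by (intro Suc.prems(1)[of D]) auto
qed

text \<open>Here \<open>B1\<close> and \<open>B2\<close> are bases. The set \<open>C\<close> in the proof is the fundamental circuit of \<open>i\<close> in
  \<open>insert i B2\<close>, without \<open>i\<close> itself. If no element of \<open>C\<close> outside \<open>B1\<close> could replace \<open>i\<close> in \<open>B1\<close>, then \<open>B1 - {i}\<close> would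
  span \<open>C\<close> and hence \<open>i\<close>.\<close>

lemma matroid_symmetric_exchange:
  assumes I: "matroid I" and B1: "B1 \<in> I" and B2: "B2 \<in> I"
    and max1: "\<And>e. e \<notin> B1 \<Longrightarrow> insert e B1 \<notin> I"
    and max2: "\<And>e. e \<notin> B2 \<Longrightarrow> insert e B2 \<notin> I"
    and i: "i \<in> B1" "i \<notin> B2"
  obtains j where "j \<in> B2" "j \<notin> B1" "insert j (B1 - {i}) \<in> I" "insert i (B2 - {j}) \<in> I"
proof -
  define C where "C = {j \<in> B2. insert i (B2 - {j}) \<in> I}"
  have "C \<subseteq> B2" by (auto simp: C_def)
  have C: "C \<in> I" using matroid_subset[OF I B2 \<open>C \<subseteq> B2\<close>] .
  have Ci: "insert i C \<notin> I"
  proof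
    assume *: "insert i C \<in> I"
    have "C \<noteq> B2" using * max2[OF i(2)] by auto
    with \<open>C \<subseteq> B2\<close> have "card C < card B2" by (intro psubset_card_mono) auto
    moreover have "card (insert i C) = Suc (card C)"
      using i \<open>C \<subseteq> B2\<close> by (intro card_insert_disjoint) auto
    ultimately have "card (insert i C) \<le> card B2" by simp
    from matroid_extend[OF I * B2 this]
    obtain D where D: "D \<in> I" "insert i C \<subseteq> D" "D \<subseteq> insert i C \<union> B2" "card D = card B2" .
    have "\<not> B2 \<subseteq> D"
    proof
      assume "B2 \<subseteq> D"
      then have "insert i B2 \<subseteq> D" using D(2) by auto
      then have "card (insert i B2) \<le> card D" by (intro card_mono) auto
      with D(4) i show False by simp
    qed
    then obtain j where j: "j \<in> B2" "j \<notin> D" by auto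
    have "D \<subseteq> insert i (B2 - {j})" using D(3) j \<open>C \<subseteq> B2\<close> by auto
    moreover have "card (insert i (B2 - {j})) = card D"
      using card_Suc_Diff1[of B2 j] card_insert_disjoint[of "B2 - {j}" i] i j D(4) by simp
    ultimately have "insert i (B2 - {j}) = D"
      by (metis card_subset_eq finite)
    with D(1) j have "j \<in> C" by (simp add: C_def)
    with D(2) j show False by auto
  qed
  have "\<exists>j\<in>C - B1. insert j (B1 - {i}) \<in> I"
  proof (rule ccontr)
    assume "\<not> ?thesis"
    then have no: "insert e (B1 - {i}) \<notin> I" if "e \<in> C" "e \<notin> B1" for e
      using that by auto
    have iC: "i \<notin> C" using i \<open>C \<subseteq> B2\<close> by auto
    have B1i: "B1 - {i} \<in> I" using matroid_subset[OF I B1] by auto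
    have small: "card D \<le> card (B1 - {i})" if "D \<in> I" "D \<subseteq> (B1 - {i}) \<union> C" for D
    proof (rule ccontr)
      assume "\<not> ?thesis"
      then have "card (B1 - {i}) < card D" by simp
      from matroid_augment[OF I B1i \<open>D \<in> I\<close> this]
      obtain e where "e \<in> D" "e \<notin> B1 - {i}" "insert e (B1 - {i}) \<in> I" by metis
      then show False using no[of e] \<open>D \<subseteq> (B1 - {i}) \<union> C\<close> iC by auto
    qed
    from matroid_extend[OF I C B1i small[OF C Un_upper2]]
    obtain D where D: "D \<in> I" "C \<subseteq> D" "D \<subseteq> C \<union> (B1 - {i})" "card D = card (B1 - {i})" .
    have "card D < card B1" using D(4) i by (metis card_Diff1_less finite)
    then obtain e where e: "e \<in> B1" "e \<notin> D" "insert e D \<in> I"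
      using matroid_augment[OF I D(1) B1] by blast
    show False
    proof (cases "e = i")
      case True
      then show False using Ci matroid_subset[OF I e(3), of "insert i C"] D(2) by auto
    next
      case False
      then have "card (insert e D) \<le> card (B1 - {i})"
        using D(3) e by (intro small) auto
      with D(4) e(2) show False by simp
    qed
  qed
  then obtain j where "j \<in> C" "j \<notin> B1" "insert j (B1 - {i}) \<in> I" by auto
  then show thesis by (intro that[of j]) (auto simp: C_def)
qed

abbreviation indicator_vec :: "'v set \<Rightarrow> real ^ 'v::finite" where
  "indicator_vec S \<equiv> (\<chi> i. indicator S i)"

lemma matroid_polytope_subset_cube: "matroid_polytope I \<subseteq> cbox 0 1"
  unfolding matroid_polytope_def
  by (intro hull_minimal) (auto simp: mem_box_cart indicator_def)

lemma compact_matroid_polytope: "compact (matroid_polytope I)"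
  unfolding matroid_polytope_def by (intro finite_imp_compact_convex_hull) auto

lemma convex_matroid_polytope: "convex (matroid_polytope I)"
  unfolding matroid_polytope_def by (rule convex_convex_hull)

lemma indicator_vec_in_matroid_polytope: "S \<in> I \<Longrightarrow> indicator_vec S \<in> matroid_polytope I"
  unfolding matroid_polytope_def by (intro hull_inc) auto

lemma matroid_polytope_eq_0:
  assumes "matroid I" "y \<in> matroid_polytope I" "{i} \<notin> I"
  shows "y $ i = 0"
proof -
  have "i \<notin> S" if "S \<in> I" for S
    using matroid_subset[OF assms(1) that, of "{i}"] assms(3) by auto
  then have "indicator_vec ` I \<subseteq> {y. axis i 1 \<bullet> y = 0}"
    by (auto simp: inner_axis')
  then have "matroid_polytope I \<subseteq> {y. axis i 1 \<bullet> y = 0}"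
    unfolding matroid_polytope_def by (intro hull_minimal convex_hyperplane)
  with assms(2) show ?thesis by (auto simp: inner_axis')
qed

lemma continuous_on_subset_mean: "continuous_on A (\<lambda>y. subset_mean y g)"
proof -
  have "continuous_on A (\<lambda>y. if i \<in> R then y $ i else 1 - y $ i)" for i and R :: "'a set"
    by (cases "i \<in> R") (auto intro!: continuous_intros)
  then show ?thesis
    unfolding subset_mean_def subset_weight_def by (intro continuous_intros)
qed

lemma matroid_polytope_weights:
  assumes "y \<in> matroid_polytope I"
  obtains u where "\<And>S. S \<in> I \<Longrightarrow> 0 \<le> u S" "sum u I = 1" "y = (\<Sum>S\<in>I. u S *\<^sub>R indicator_vec S)"
proof -
  obtain u where u: "\<forall>v\<in>indicator_vec ` I. 0 \<le> u v" "sum u (indicator_vec ` I) = 1"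
    "(\<Sum>v\<in>indicator_vec ` I. u v *\<^sub>R v) = y"
    using assms unfolding matroid_polytope_def by (subst (asm) convex_hull_finite) auto
  have inj: "inj_on (indicator_vec :: 'a set \<Rightarrow> _) I"
    by (rule inj_onI) (simp add: vec_eq_iff set_eq_iff indicator_eq_1_iff indicator_eq_0_iff indicator_def of_bool_eq_iff)
  show thesis
    using u by (intro that[of "u \<circ> indicator_vec"]) (auto simp: sum.reindex[OF inj] o_def)
qed

text \<open>Weight can be moved from \<open>S\<close> to any other independent set.\<close>

lemma matroid_polytope_shift:
  assumes u: "\<And>S. S \<in> I \<Longrightarrow> 0 \<le> u S" "sum u I = 1"
    and "S \<in> I" "S' \<in> I" "0 \<le> \<delta>" "\<delta> \<le> u S"
  shows "(\<Sum>S\<in>I. u S *\<^sub>R indicator_vec S) + \<delta> *\<^sub>R (indicator_vec S' - indicator_vec S) \<in> matroid_polytope I"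
proof -
  define w where "w T = u T + ((if T = S' then \<delta> else 0) - (if T = S then \<delta> else 0))" for T
  have d: "(if T = A then \<delta> else 0) *\<^sub>R z = (if T = A then \<delta> *\<^sub>R z else 0)" for T A and z :: "real ^ 'a"
    by simp
  have "(\<Sum>T\<in>I. w T *\<^sub>R indicator_vec T) \<in> matroid_polytope I"
  proof (rule convex_sum[OF _ convex_matroid_polytope])
    show "sum w I = 1"
      using assms by (simp add: w_def sum.distrib sum_subtractf)
    show "0 \<le> w T" if "T \<in> I" for T
      using assms u(1)[OF that] by (auto simp: w_def)
  qed (auto intro: indicator_vec_in_matroid_polytope)
  also have "(\<Sum>T\<in>I. w T *\<^sub>R indicator_vec T) =
     (\<Sum>S\<in>I. u S *\<^sub>R indicator_vec S) + \<delta> *\<^sub>R (indicator_vec S' - indicator_vec S)"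
    using assms(3,4) by (simp add: w_def scaleR_left_distrib scaleR_left_diff_distrib sum.distrib
        sum_subtractf d scaleR_right_diff_distrib)
  finally show ?thesis .
qed

text \<open>The extension has its maximum over the matroid polytope at a vertex. Among the maximisers \<open>z\<close> take
  one of largest norm and write it as a convex combination of independent sets. By monotonicity,
  adding an element to a set in the support would give a longer maximiser, so the support consists
  of bases. For two different bases in the support a symmetric exchange of \<open>i\<close> and \<open>j\<close> allows to move
  \<open>z\<close> both ways along \<open>axis i 1 - axis j 1\<close>. Submodularity makes the extension convex in this
  direction, so both moves lead to maximisers, and one of them is longer than \<open>z\<close>. Hence \<open>z\<close> is the
  indicator vector of a single independent set.\<close>

lemma subset_mean_le_Max:
  fixes g :: "'v::finite set \<Rightarrow> real"
  assumes I: "matroid I" and "mono g" and sub: "submodular g" and y: "y \<in> matroid_polytope I"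
  shows "subset_mean y g \<le> (MAX S\<in>I. g S)"
proof -
  define K where "K = matroid_polytope I"
  define F where "F z = subset_mean z g" for z :: "real ^ 'v"
  have K: "compact K" "K \<noteq> {}" "K \<subseteq> cbox 0 1"
    using compact_matroid_polytope y matroid_polytope_subset_cube by (auto simp: K_def)
  have contF: "continuous_on A F" for A
    unfolding F_def by (rule continuous_on_subset_mean)
  obtain m where m: "m \<in> K" "\<And>z. z \<in> K \<Longrightarrow> F z \<le> F m"
    using continuous_attains_sup[OF K(1,2) contF] by auto
  define A where "A = K \<inter> F -` {F m}"
  have "compact A"
    using closed_Int_compact[OF continuous_closed_preimage[OF contF compact_imp_closed[OF K(1)]
        closed_singleton] K(1)]
    unfolding A_def by (simp add: Int_ac)
  then obtain z where z: "z \<in> A" "\<And>z'. z' \<in> A \<Longrightarrow> norm z' \<le> norm z"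
    using continuous_attains_sup[of A norm] m(1) by (auto simp: A_def intro: continuous_intros)
  then have Fz: "F z = F m" "z \<in> K" by (auto simp: A_def)
  then have zc: "z \<in> cbox 0 1" using K by auto
  have top: "norm z' \<le> norm z" if "z' \<in> K" "F z \<le> F z'" for z'
    using that m(2)[of z'] Fz by (intro z(2)) (auto simp: A_def)
  obtain u where u: "\<And>S. S \<in> I \<Longrightarrow> 0 \<le> u S" "sum u I = 1" and zu: "z = (\<Sum>S\<in>I. u S *\<^sub>R indicator_vec S)"
    using Fz(2) matroid_polytope_weights unfolding K_def by metis
  note shift = matroid_polytope_shift[of I u, OF u, folded zu K_def]
  have maximal: "insert e S \<notin> I" if S: "S \<in> I" "u S > 0" and e: "e \<notin> S" for S e
  proof
    assume "insert e S \<in> I"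
    then have "z + u S *\<^sub>R (indicator_vec (insert e S) - indicator_vec S) \<in> K"
      using S by (intro shift) auto
    also have "u S *\<^sub>R (indicator_vec (insert e S) - indicator_vec S) = axis e (u S)"
      using e by (auto simp: vec_eq_iff axis_def indicator_def)
    finally have "z + axis e (u S) \<in> K" .
    moreover have "F z \<le> F (z + axis e (u S))"
      unfolding F_def subset_mean_shift
      using S subset_mean_mono[OF zc, of "\<lambda>_. 0" "marginal e g"] marginal_nonneg[OF \<open>mono g\<close>]
      by simp
    ultimately have "norm (z + axis e (u S)) \<le> norm z" by (rule top)
    then have "(z + axis e (u S)) \<bullet> (z + axis e (u S)) \<le> z \<bullet> z"
      by (simp add: norm_le)
    then have "2 * (u S * z $ e) + u S * u S \<le> 0"
      by (simp add: inner_add inner_axis inner_axis' algebra_simps)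
    moreover have "0 \<le> z $ e" using zc by (auto simp: mem_box_cart)
    ultimately show False using S(2) mult_pos_pos[OF S(2) S(2)] mult_nonneg_nonneg[of "u S" "z $ e"] by linarith
  qed
  have unique: "S1 = S2" if S1: "S1 \<in> I" "u S1 > 0" and S2: "S2 \<in> I" "u S2 > 0" for S1 S2
  proof (rule ccontr)
    assume "S1 \<noteq> S2"
    have "\<not> S1 \<subseteq> S2"
    proof
      assume "S1 \<subseteq> S2"
      with \<open>S1 \<noteq> S2\<close> obtain e where "e \<in> S2" "e \<notin> S1" by auto
      with maximal[OF S1, of e] matroid_subset[OF I S2(1), of "insert e S1"] \<open>S1 \<subseteq> S2\<close>
      show False by auto
    qed
    then obtain i where i: "i \<in> S1" "i \<notin> S2" by auto
    obtain j where j: "j \<in> S2" "j \<notin> S1" "insert j (S1 - {i}) \<in> I" "insert i (S2 - {j}) \<in> I"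
      using matroid_symmetric_exchange[OF I S1(1) S2(1) maximal[OF S1] maximal[OF S2] i] by blast
    have "i \<noteq> j" using i j by auto
    define \<delta> where "\<delta> = min (u S1) (u S2)"
    have \<delta>: "0 < \<delta>" "\<delta> \<le> u S1" "\<delta> \<le> u S2" using S1 S2 by (auto simp: \<delta>_def)
    have "z + \<delta> *\<^sub>R (indicator_vec (insert i (S2 - {j})) - indicator_vec S2) \<in> K"
      using S2 j \<delta> by (intro shift) auto
    also have "\<delta> *\<^sub>R (indicator_vec (insert i (S2 - {j})) - indicator_vec S2) = axis i \<delta> + axis j (-\<delta>)"
      using i j \<open>i \<noteq> j\<close> by (auto simp: vec_eq_iff axis_def indicator_def)
    finally have p: "z + axis i \<delta> + axis j (-\<delta>) \<in> K" by (simp add: add.assoc)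
    have "z + \<delta> *\<^sub>R (indicator_vec (insert j (S1 - {i})) - indicator_vec S1) \<in> K"
      using S1 j \<delta> by (intro shift) auto
    also have "\<delta> *\<^sub>R (indicator_vec (insert j (S1 - {i})) - indicator_vec S1) = axis i (-\<delta>) + axis j \<delta>"
      using i j \<open>i \<noteq> j\<close> by (auto simp: vec_eq_iff axis_def indicator_def)
    finally have q: "z + axis i (-\<delta>) + axis j \<delta> \<in> K" by (simp add: add.assoc)
    have two: "F (z + axis i a + axis j b) = F z + a * subset_mean z (marginal i g)
        + b * subset_mean z (marginal j g) + a * b * subset_mean z (marginal i (marginal j g))" for a b
      unfolding F_def subset_mean_shift by (simp add: algebra_simps)
    have "subset_mean z (marginal i (marginal j g)) \<le> subset_mean z (\<lambda>_. 0)"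
      using marginal_marginal_nonpos[OF sub \<open>i \<noteq> j\<close>] by (intro subset_mean_mono[OF zc])
    then have "subset_mean z (marginal i (marginal j g)) \<le> 0" by simp
    then have "\<delta> * \<delta> * subset_mean z (marginal i (marginal j g)) \<le> 0"
      using \<delta>(1) by (intro mult_nonneg_nonpos) auto
    then have "2 * F z \<le> F (z + axis i \<delta> + axis j (-\<delta>)) + F (z + axis i (-\<delta>) + axis j \<delta>)"
      unfolding two by simp
    moreover have "F (z + axis i \<delta> + axis j (-\<delta>)) \<le> F z" "F (z + axis i (-\<delta>) + axis j \<delta>) \<le> F z"
      using m(2) p q Fz by auto
    ultimately have "F z \<le> F (z + axis i \<delta> + axis j (-\<delta>))" "F z \<le> F (z + axis i (-\<delta>) + axis j \<delta>)"
      by linarith+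
    with top p q have n: "norm (z + axis i \<delta> + axis j (-\<delta>)) \<le> norm z" "norm (z + axis i (-\<delta>) + axis j \<delta>) \<le> norm z"
      by auto
    define d :: "real ^ 'v" where "d = axis i \<delta> + axis j (-\<delta>)"
    have "z + axis i \<delta> + axis j (-\<delta>) = z + d" "z + axis i (-\<delta>) + axis j \<delta> = z - d"
      by (auto simp: d_def vec_eq_iff axis_def)
    with n have "(z + d) \<bullet> (z + d) \<le> z \<bullet> z" "(z - d) \<bullet> (z - d) \<le> z \<bullet> z"
      by (auto simp: norm_le)
    then have "d \<bullet> d \<le> 0" by (simp add: inner_add inner_diff inner_commute)
    then have "d = 0" by (metis inner_ge_zero inner_eq_zero_iff order_antisym)
    moreover have "d $ i = \<delta>" using \<open>i \<noteq> j\<close> by (simp add: d_def axis_def)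
    ultimately show False using \<delta>(1) by simp
  qed
  obtain S where S: "S \<in> I" "u S > 0"
    using u by (metis less_eq_real_def sum.neutral zero_neq_one)
  then have zero: "u T = 0" if "T \<in> I - {S}" for T
    using unique[of T S] u(1)[of T] that by force
  have "u S = 1"
    using u(2) sum.remove[OF _ S(1), of u] zero by simp
  then have "z = indicator_vec S"
    unfolding zu using sum.remove[OF _ S(1), of "\<lambda>S. u S *\<^sub>R indicator_vec S"] zero by simp
  then have "F z = g S" by (simp add: F_def subset_mean_indicator)
  then have "subset_mean y g \<le> g S"
    using m(2)[of y] y Fz by (simp add: F_def K_def)
  also have "\<dots> \<le> (MAX S\<in>I. g S)" using S(1) by (intro Max_ge) auto
  finally show ?thesis .
qed

section \<open>Extragradient steps\<close>

text \<open>The vectors \<open>p\<close> and \<open>q\<close> are the scaled gradients at the current point \<open>x\<close> and at the extrapolated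
  point \<open>xh\<close>. The starting point \<open>x\<close> need not belong to \<open>X\<close>.\<close>

lemma extragradient_step:
  fixes X :: "'a::euclidean_space set" and x p q u :: 'a
  assumes "convex X" "closed X" "u \<in> X"
  defines "xh \<equiv> closest_point X (x - p)" and "xp \<equiv> closest_point X (x - q)"
  shows "2 * (q \<bullet> (xh - u)) \<le>
    (norm (x - u))\<^sup>2 - (norm (xp - u))\<^sup>2 - (norm (xh - x))\<^sup>2 + (norm (q - p))\<^sup>2"
proof -
  have "xp \<in> X"
    unfolding xp_def using assms(2,3) by (intro closest_point_in_set) auto
  have 1: "(x - q - xp) \<bullet> (u - xp) \<le> 0"
    unfolding xp_def by (rule closest_point_dot[OF assms(1-3)])
  have 2: "(x - p - xh) \<bullet> (xp - xh) \<le> 0"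
    unfolding xh_def by (rule closest_point_dot[OF assms(1,2) \<open>xp \<in> X\<close>])
  have "(norm (x - u))\<^sup>2 - (norm (xp - u))\<^sup>2 - (norm (xh - x))\<^sup>2 + (norm (q - p))\<^sup>2 - 2 * (q \<bullet> (xh - u))
    = (norm ((q - p) + (xp - xh)))\<^sup>2 - 2 * ((x - q - xp) \<bullet> (u - xp)) - 2 * ((x - p - xh) \<bullet> (xp - xh))"
    unfolding power2_norm_eq_inner by (simp add: inner_diff inner_add inner_commute algebra_simps)
  with 1 2 show ?thesis
    using zero_le_power2[of "norm ((q - p) + (xp - xh))"] by linarith
qed

section \<open>The convex-submodular saddle problem\<close>

text \<open>Only the functions \<open>f \<cdot> S\<close> with \<open>S\<close> independent have gradients that are assumed to be Lipschitz,
  while all of them have bounded gradients.\<close>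

locale submodular_saddle =
  fixes f :: "'x::euclidean_space \<Rightarrow> 'v::finite set \<Rightarrow> real"
    and X :: "'x set" and I :: "'v set set" and L M :: real
  assumes X: "X \<noteq> {}" "closed X" "convex X" "bounded X"
    and matroid: "matroid I"
    and f_nonneg: "\<And>x S. 0 \<le> f x S"
    and f_convex: "\<And>S. convex_on UNIV (\<lambda>x. f x S)"
    and f_mono: "\<And>x. mono (f x)"
    and f_submodular: "\<And>x. submodular (f x)"
    and f_differentiable: "\<And>x S. (\<lambda>x. f x S) differentiable (at x)"
    and L_pos: "L > 0"
    and gradient_lipschitz: "\<And>x x' S. S \<in> I \<Longrightarrow>
      norm (gradient (\<lambda>x. f x S) x - gradient (\<lambda>x. f x S) x') \<le> L * norm (x - x')"
    and gradient_bounded: "\<And>x S. norm (gradient (\<lambda>x. f x S) x) \<le> M"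
begin

abbreviation df :: "'v set \<Rightarrow> 'x \<Rightarrow> 'x" where
  "df S x \<equiv> gradient (\<lambda>x. f x S) x"

abbreviation K :: "(real ^ 'v) set" where
  "K \<equiv> matroid_polytope I"

text \<open>Closed forms of the two partial gradients of the multilinear extension, and the expected marginal
  deficit.\<close>

definition grad_x :: "'x \<Rightarrow> real ^ 'v \<Rightarrow> 'x" where
  "grad_x x y = (\<Sum>R\<in>UNIV. subset_weight y R *\<^sub>R df R x)"

definition grad_y :: "'x \<Rightarrow> real ^ 'v \<Rightarrow> real ^ 'v" where
  "grad_y x y = (\<chi> i. subset_mean y (marginal i (f x)))"

definition deficit :: "'x \<Rightarrow> real ^ 'v \<Rightarrow> real" where
  "deficit x y = subset_mean y (marginal_deficit (f x))"

lemma empty_indep: "{} \<in> I"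
  using matroid matroid_subset[OF matroid, of _ "{}"] unfolding matroid_def by auto

lemma K_cube: "y \<in> K \<Longrightarrow> y \<in> cbox 0 1"
  using matroid_polytope_subset_cube by auto

lemma df: "((\<lambda>x. f x S) has_derivative (\<lambda>d. df S x \<bullet> d)) (at x)"
  by (rule has_derivative_gradient[OF f_differentiable])

lemma gradient_multilinear_ext:
  assumes "y \<in> cbox 0 1"
  shows "gradient (\<lambda>x. multilinear_ext f x y) x = grad_x x y"
proof (rule gradient_eqI)
  have "((\<lambda>x. \<Sum>R\<in>UNIV. subset_weight y R * f x R) has_derivative
      (\<lambda>d. \<Sum>R\<in>UNIV. subset_weight y R * (df R x \<bullet> d))) (at x)"
    by (intro has_derivative_sum has_derivative_mult_right df)
  then show "((\<lambda>x. multilinear_ext f x y) has_derivative (\<lambda>d. grad_x x y \<bullet> d)) (at x)"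
    by (simp add: multilinear_ext_eq_subset_mean[OF assms] subset_mean_def grad_x_def inner_sum_left)
qed

lemma subset_mean_tangent:
  assumes "y \<in> cbox 0 1"
  shows "subset_mean y (f x) + grad_x x y \<bullet> (u - x) \<le> subset_mean y (f u)"
proof -
  have "subset_mean y (f x) + grad_x x y \<bullet> (u - x) = subset_mean y (\<lambda>R. f x R + df R x \<bullet> (u - x))"
    by (simp add: subset_mean_add grad_x_def inner_sum_left subset_mean_def)
  also have "\<dots> \<le> subset_mean y (f u)"
    by (intro subset_mean_mono[OF assms] convex_on_above_tangent[OF f_convex df])
  finally show ?thesis .
qed

lemma M_nonneg: "0 \<le> M"
  using gradient_bounded norm_ge_zero order_trans by blast

lemma f_lipschitz: "\<bar>f x S - f x' S\<bar> \<le> M * norm (x - x')"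
proof -
  have "f x S - f x' S \<le> M * norm (x - x')" for x x'
  proof -
    have "f x S - f x' S \<le> df S x \<bullet> (x - x')"
      using convex_on_above_tangent[OF f_convex df, of x S x'] by (simp add: inner_diff_right)
    also have "\<dots> \<le> norm (df S x) * norm (x - x')" by (rule norm_cauchy_schwarz)
    also have "\<dots> \<le> M * norm (x - x')" by (intro mult_right_mono gradient_bounded) simp
    finally show ?thesis .
  qed
  from this[of x x'] this[of x' x] show ?thesis by (simp add: norm_minus_commute)
qed

lemma marginal_deficit_nonneg: "0 \<le> marginal_deficit (f x) R"
  using sum_last_marginals_le[OF f_submodular, of R R x] f_nonneg[of x "{}"]
  by (simp add: marginal_deficit_def)

lemma additive_gap_le: "additive_gap (f x) R \<le> CARD('v) * marginal_deficit (f x) R"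
proof -
  have "additive_gap (f x) R \<le> card R * marginal_deficit (f x) R"
    by (rule additive_gap_le_deficit[OF f_submodular]) simp
  also have "\<dots> \<le> CARD('v) * marginal_deficit (f x) R"
    using marginal_deficit_nonneg by (intro mult_right_mono) (auto intro: card_mono)
  finally show ?thesis .
qed

text \<open>For a set \<open>R\<close> of non-loops, \<open>f x {} + (\<Sum>i\<in>R. f x {i})\<close> has a Lipschitz gradient in \<open>x\<close> and
  bounds \<open>f x R\<close> from above, whether or not \<open>R\<close> is independent.\<close>

lemma df_diff:
  assumes "\<And>i. i \<in> R \<Longrightarrow> {i} \<in> I"
  defines "L' \<equiv> (CARD('v) + 1) * L"
  shows "(norm (df R x - df R z))\<^sup>2 \<le> 9 * L'\<^sup>2 * (norm (x - z))\<^sup>2 + 18 * L' * additive_gap (f z) R"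
proof -
  define s where "s x = f x {} + (\<Sum>i\<in>R. f x {i})" for x
  define gs where "gs x = df {} x + (\<Sum>i\<in>R. df {i} x)" for x
  have "(norm (df R x - df R z))\<^sup>2 \<le> 9 * L'\<^sup>2 * (norm (x - z))\<^sup>2 + 18 * L' * (s z - f z R)"
  proof (rule gradient_diff_below_smooth[OF f_convex df])
    show "(s has_derivative (\<lambda>d. gs x \<bullet> d)) (at x)" for x
      unfolding s_def gs_def inner_add_left inner_sum_left
      by (intro has_derivative_add has_derivative_sum df)
    show "norm (gs x - gs x') \<le> L' * norm (x - x')" for x x'
    proof -
      have "gs x - gs x' = (df {} x - df {} x') + (\<Sum>i\<in>R. df {i} x - df {i} x')"
        by (simp add: gs_def sum_subtractf)
      also have "norm \<dots> \<le> norm (df {} x - df {} x') + norm (\<Sum>i\<in>R. df {i} x - df {i} x')"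
        by (rule norm_triangle_ineq)
      also have "\<dots> \<le> L * norm (x - x') + (\<Sum>i\<in>R. L * norm (x - x'))"
        using assms(1) empty_indep by (intro add_mono sum_norm_le gradient_lipschitz) auto
      also have "\<dots> = (card R + 1) * L * norm (x - x')"
        by (simp add: algebra_simps)
      also have "\<dots> \<le> L' * norm (x - x')"
        unfolding L'_def using L_pos by (intro mult_right_mono) (auto intro: card_mono)
      finally show ?thesis .
    qed
    show "L' > 0" using L_pos by (simp add: L'_def)
    show "f x R \<le> s x" for x
      using additive_gap_nonneg[OF f_submodular f_nonneg, of R x] by (simp add: additive_gap_def s_def)
  qed
  then show ?thesis by (simp add: s_def additive_gap_def)
qed

lemma deficit_nonneg:
  assumes "y \<in> K"
  shows "0 \<le> deficit x y"
  using subset_mean_mono[OF K_cube[OF assms], of "\<lambda>_. 0"] marginal_deficit_nonneg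
  unfolding deficit_def by simp

text \<open>The gradient in \<open>x\<close> is Lipschitz up to the expected deficit at one of the two points.\<close>

lemma grad_x_diff:
  "\<exists>C\<ge>0. \<forall>x x'. \<forall>y\<in>K. \<forall>y'\<in>K. (norm (grad_x x' y' - grad_x x y))\<^sup>2
     \<le> C * ((norm (x' - x))\<^sup>2 + (norm (y' - y))\<^sup>2 + deficit x' y')"
proof -
  define n where "n = real CARD('v)"
  define L' where "L' = (CARD('v) + 1) * L"
  define B where "B = real CARD('v set) * (n * M)"
  define C where "C = 2 * (9 * L'\<^sup>2 + 18 * L' * n + B\<^sup>2)"
  have pos: "0 \<le> n" "0 < L'" "0 \<le> B" using L_pos M_nonneg by (auto simp: n_def L'_def B_def)
  have "(norm (grad_x x' y' - grad_x x y))\<^sup>2 \<le> C * ((norm (x' - x))\<^sup>2 + (norm (y' - y))\<^sup>2 + deficit x' y')"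
    if y: "y \<in> K" "y' \<in> K" for x x' y y'
  proof -
    note cube = K_cube[OF y(1)] K_cube[OF y(2)]
    define a where "a = (\<Sum>R\<in>UNIV. subset_weight y' R *\<^sub>R (df R x' - df R x))"
    define b where "b = (\<Sum>R\<in>UNIV. (subset_weight y' R - subset_weight y R) *\<^sub>R df R x)"
    have ab: "grad_x x' y' - grad_x x y = a + b"
      unfolding grad_x_def a_def b_def sum_subtractf[symmetric] sum.distrib[symmetric]
      by (simp add: algebra_simps)
    \<comment> \<open>\<open>b\<close>: change of the weights; only boundedness of the gradients is needed\<close>
    have "norm b \<le> (\<Sum>R\<in>(UNIV :: 'v set set). n * norm (y' - y) * M)"
      unfolding b_def
    proof (rule sum_norm_le)
      fix R
      have "\<bar>subset_weight y' R - subset_weight y R\<bar> \<le> n * norm (y' - y)"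
        unfolding n_def by (rule abs_subset_weight_diff[OF cube(2,1)])
      then show "norm ((subset_weight y' R - subset_weight y R) *\<^sub>R df R x) \<le> n * norm (y' - y) * M"
        using gradient_bounded pos by (auto intro!: mult_mono)
    qed
    also have "\<dots> = B * norm (y' - y)" by (simp add: B_def)
    finally have b: "(norm b)\<^sup>2 \<le> B\<^sup>2 * (norm (y' - y))\<^sup>2"
      unfolding power_mult_distrib[symmetric] by (intro power_mono) auto
    \<comment> \<open>\<open>a\<close>: change of the gradients, averaged with the weights at \<open>y'\<close>; its square is at most the average of the squares\<close>
    have "norm a \<le> subset_mean y' (\<lambda>R. norm (df R x' - df R x))"
      unfolding a_def subset_mean_def using subset_weight_nonneg[OF cube(2)]
      by (intro sum_norm_le) simp
    then have "(norm a)\<^sup>2 \<le> (subset_mean y' (\<lambda>R. norm (df R x' - df R x)))\<^sup>2"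
      by (intro power_mono) auto
    also have "\<dots> \<le> subset_mean y' (\<lambda>R. (norm (df R x' - df R x))\<^sup>2)"
      by (rule subset_mean_square_le[OF cube(2)])
    also have "\<dots> \<le> subset_mean y' (\<lambda>R. 9 * L'\<^sup>2 * (norm (x' - x))\<^sup>2 + 18 * L' * n * marginal_deficit (f x') R)"
      unfolding subset_mean_def
    proof (rule sum_mono)
      fix R
      show "subset_weight y' R * (norm (df R x' - df R x))\<^sup>2
        \<le> subset_weight y' R * (9 * L'\<^sup>2 * (norm (x' - x))\<^sup>2 + 18 * L' * n * marginal_deficit (f x') R)"
      proof (cases "\<forall>i\<in>R. {i} \<in> I")
        case True
        have "(norm (df R x - df R x'))\<^sup>2 \<le> 9 * L'\<^sup>2 * (norm (x - x'))\<^sup>2 + 18 * L' * additive_gap (f x') R"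
          unfolding L'_def using True by (intro df_diff) auto
        also have "\<dots> \<le> 9 * L'\<^sup>2 * (norm (x - x'))\<^sup>2 + 18 * L' * (n * marginal_deficit (f x') R)"
          unfolding n_def using pos by (intro add_left_mono mult_left_mono additive_gap_le) auto
        finally show ?thesis
          using subset_weight_nonneg[OF cube(2), of R]
          by (intro mult_left_mono) (auto simp: norm_minus_commute mult.assoc)
      next
        case False
        then obtain i where "i \<in> R" "{i} \<notin> I" by auto
        \<comment> \<open>a set that contains a loop has probability zero on the polytope\<close>
        then have "subset_weight y' R = 0"
          using subset_weight_eq_0 matroid_polytope_eq_0[OF matroid y(2)] by blast
        then show ?thesis by simp
      qed
    qed
    also have "\<dots> = 9 * L'\<^sup>2 * (norm (x' - x))\<^sup>2 + 18 * L' * n * deficit x' y'"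
      by (simp add: subset_mean_add subset_mean_cmult deficit_def)
    finally have a: "(norm a)\<^sup>2 \<le> 9 * L'\<^sup>2 * (norm (x' - x))\<^sup>2 + 18 * L' * n * deficit x' y'" .
    have "(norm (a + b))\<^sup>2 \<le> (norm a + norm b)\<^sup>2"
      by (intro power_mono norm_triangle_ineq) simp
    also have "\<dots> \<le> 2 * (norm a)\<^sup>2 + 2 * (norm b)\<^sup>2"
      using zero_le_power2[of "norm a - norm b"] by (simp add: power2_eq_square algebra_simps)
    also have "\<dots> \<le> 2 * (9 * L'\<^sup>2 * (norm (x' - x))\<^sup>2 + 18 * L' * n * deficit x' y' + B\<^sup>2 * (norm (y' - y))\<^sup>2)"
      using a b by simp
    also have "\<dots> \<le> C * ((norm (x' - x))\<^sup>2 + (norm (y' - y))\<^sup>2 + deficit x' y')"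
    proof -
      have "0 \<le> 18 * L' * n * ((norm (x' - x))\<^sup>2 + (norm (y' - y))\<^sup>2)"
        "0 \<le> 9 * L'\<^sup>2 * ((norm (y' - y))\<^sup>2 + deficit x' y')"
        "0 \<le> B\<^sup>2 * ((norm (x' - x))\<^sup>2 + deficit x' y')"
        using pos deficit_nonneg[OF y(2)] by (auto intro!: mult_nonneg_nonneg add_nonneg_nonneg)
      then show ?thesis by (simp add: C_def algebra_simps)
    qed
    finally show ?thesis by (simp add: ab)
  qed
  moreover have "0 \<le> C" using pos by (simp add: C_def)
  ultimately show ?thesis by blast
qed

lemma grad_y_diff:
  "\<exists>C\<ge>0. \<forall>x\<in>insert 0 X. \<forall>x'. \<forall>y\<in>K. \<forall>y'\<in>K. (norm (grad_y x' y' - grad_y x y))\<^sup>2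
     \<le> C * ((norm (x' - x))\<^sup>2 + (norm (y' - y))\<^sup>2)"
proof -
  obtain r where r: "\<And>x. x \<in> insert 0 X \<Longrightarrow> norm x \<le> r"
    using bounded_insert[of 0 X] X(4) unfolding bounded_iff by blast
  define n where "n = real CARD('v)"
  define F where "F = f 0 UNIV + M * r"
  define B where "B = real CARD('v set) * (n * F)"
  define C where "C = n * (2 * M + B)"
  have "0 \<le> r" using r[of 0] by simp
  then have pos: "0 \<le> n" "0 \<le> F" "0 \<le> B" "0 \<le> C"
    using M_nonneg f_nonneg by (auto simp: n_def F_def B_def C_def)
  have f_le: "f x S \<le> F" if "x \<in> insert 0 X" for x S
  proof -
    have "f x S \<le> f x UNIV" using f_mono by (auto intro: monoD)
    also have "\<dots> \<le> f 0 UNIV + M * norm x" using f_lipschitz[of x UNIV 0] by auto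
    also have "\<dots> \<le> F" unfolding F_def using r[OF that] M_nonneg by (auto intro: mult_left_mono)
    finally show ?thesis .
  qed
  have "(norm (grad_y x' y' - grad_y x y))\<^sup>2 \<le> 2 * C\<^sup>2 * ((norm (x' - x))\<^sup>2 + (norm (y' - y))\<^sup>2)"
    if x: "x \<in> insert 0 X" and y: "y \<in> K" "y' \<in> K" for x x' y y'
  proof -
    note cube = K_cube[OF y(1)] K_cube[OF y(2)]
    have comp: "\<bar>(grad_y x' y' - grad_y x y) $ i\<bar> \<le> 2 * M * norm (x' - x) + B * norm (y' - y)" for i
    proof -
      have "(grad_y x' y' - grad_y x y) $ i = subset_mean y' (\<lambda>R. marginal i (f x') R - marginal i (f x) R)
          + (\<Sum>R\<in>UNIV. (subset_weight y' R - subset_weight y R) * marginal i (f x) R)"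
        unfolding grad_y_def subset_mean_diff by (simp add: subset_mean_def sum_subtractf left_diff_distrib)
      moreover have "\<bar>subset_mean y' (\<lambda>R. marginal i (f x') R - marginal i (f x) R)\<bar> \<le> 2 * M * norm (x' - x)"
      proof -
        have "\<bar>subset_mean y' (\<lambda>R. marginal i (f x') R - marginal i (f x) R)\<bar>
            \<le> subset_mean y' (\<lambda>R. 2 * M * norm (x' - x))"
          unfolding subset_mean_def
        proof (intro sum_abs[THEN order_trans] sum_mono)
          fix R
          have "\<bar>marginal i (f x') R - marginal i (f x) R\<bar> \<le> 2 * M * norm (x' - x)"
            using f_lipschitz[of x' "insert i R" x] f_lipschitz[of x' "R - {i}" x]
            by (simp add: marginal_def)
          then show "\<bar>subset_weight y' R * (marginal i (f x') R - marginal i (f x) R)\<bar>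
              \<le> subset_weight y' R * (2 * M * norm (x' - x))"
            using subset_weight_nonneg[OF cube(2), of R] by (auto simp: abs_mult intro: mult_left_mono)
        qed
        also have "\<dots> = 2 * M * norm (x' - x)"
          by simp
        finally show ?thesis .
      qed
      moreover have "\<bar>\<Sum>R\<in>UNIV. (subset_weight y' R - subset_weight y R) * marginal i (f x) R\<bar>
          \<le> (\<Sum>R\<in>(UNIV :: 'v set set). n * norm (y' - y) * F)"
      proof (intro sum_abs[THEN order_trans] sum_mono)
        fix R
        have "\<bar>marginal i (f x) R\<bar> \<le> F"
          using f_le[OF x] f_nonneg marginal_nonneg[OF f_mono, of i x R]
          unfolding marginal_def by (smt (verit))
        moreover have "\<bar>subset_weight y' R - subset_weight y R\<bar> \<le> n * norm (y' - y)"
          unfolding n_def by (rule abs_subset_weight_diff[OF cube(2,1)])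
        ultimately show "\<bar>(subset_weight y' R - subset_weight y R) * marginal i (f x) R\<bar> \<le> n * norm (y' - y) * F"
          unfolding abs_mult using pos by (intro mult_mono) auto
      qed
      moreover have "(\<Sum>R\<in>(UNIV :: 'v set set). n * norm (y' - y) * F) = B * norm (y' - y)"
        by (simp add: B_def)
      ultimately show ?thesis by linarith
    qed
    have "norm (grad_y x' y' - grad_y x y) \<le> (\<Sum>i\<in>UNIV. \<bar>(grad_y x' y' - grad_y x y) $ i\<bar>)"
      by (rule norm_le_l1_cart)
    also have "\<dots> \<le> (\<Sum>i\<in>(UNIV :: 'v set). 2 * M * norm (x' - x) + B * norm (y' - y))"
      by (intro sum_mono comp)
    also have "\<dots> = n * (2 * M * norm (x' - x) + B * norm (y' - y))" by (simp add: n_def)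
    also have "\<dots> \<le> C * (norm (x' - x) + norm (y' - y))"
    proof -
      have "0 \<le> n * (2 * M * norm (y' - y))" "0 \<le> n * (B * norm (x' - x))"
        using pos M_nonneg by auto
      then show ?thesis by (simp add: C_def algebra_simps)
    qed
    finally have "(norm (grad_y x' y' - grad_y x y))\<^sup>2 \<le> C\<^sup>2 * (norm (x' - x) + norm (y' - y))\<^sup>2"
      unfolding power_mult_distrib[symmetric] by (intro power_mono) auto
    also have "\<dots> \<le> C\<^sup>2 * (2 * ((norm (x' - x))\<^sup>2 + (norm (y' - y))\<^sup>2))"
      using zero_le_power2[of "norm (x' - x) - norm (y' - y)"]
      by (intro mult_left_mono) (auto simp: power2_eq_square algebra_simps)
    finally show ?thesis by (simp add: algebra_simps)
  qed
  moreover have "0 \<le> 2 * C\<^sup>2" by simp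
  ultimately show ?thesis by blast
qed

text \<open>Weighted squared distance to a comparison point \<open>u\<close> and an independent set \<open>S\<close>. The second component enters with weight \<open>1/2\<close>, as the inner product with the gradient in \<open>y\<close> does in
  the first-order bound after division by 2.\<close>

definition energy :: "'x \<Rightarrow> 'v set \<Rightarrow> 'x \<times> (real ^ 'v) \<Rightarrow> real" where
  "energy u S z = (norm (fst z - u))\<^sup>2 + (norm (snd z - indicator_vec S))\<^sup>2 / 2"

lemma K_closed_convex: "convex K" "closed K" "K \<noteq> {}"
  using convex_matroid_polytope compact_matroid_polytope indicator_vec_in_matroid_polytope[OF empty_indep]
  by (auto intro: compact_imp_closed)

lemma egce_update_mem: "egce_update f X I \<gamma> z w \<in> X \<times> K"
  unfolding egce_update_def using X K_closed_convex by (auto intro!: closest_point_in_set)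

text \<open>The gradient errors of a step are of order \<open>\<gamma>\<^sup>2\<close>. The part that comes from the distances is absorbed
  by the squared step lengths, and the part that comes from the deficit by the slack of order \<open>\<gamma>\<close> in the
  first-order bound.\<close>

lemma egce_energy_decrease:
  "\<exists>\<gamma>>0. \<forall>z \<in> insert 0 X \<times> K. \<forall>u\<in>X. \<forall>S\<in>I.
     \<gamma> * (f (fst (egce_hat f X I \<gamma> z)) S - 2 * (MAX S\<in>I. f u S))
       \<le> energy u S z - energy u S (egce_update f X I \<gamma> z (egce_hat f X I \<gamma> z))"
proof -
  obtain C1 where C1: "0 \<le> C1" "\<And>x x' y y'. y \<in> K \<Longrightarrow> y' \<in> K \<Longrightarrow> (norm (grad_x x' y' - grad_x x y))\<^sup>2
     \<le> C1 * ((norm (x' - x))\<^sup>2 + (norm (y' - y))\<^sup>2 + deficit x' y')"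
    using grad_x_diff by blast
  obtain C2 where C2: "0 \<le> C2" "\<And>x x' y y'. x \<in> insert 0 X \<Longrightarrow> y \<in> K \<Longrightarrow> y' \<in> K \<Longrightarrow>
     (norm (grad_y x' y' - grad_y x y))\<^sup>2 \<le> C2 * ((norm (x' - x))\<^sup>2 + (norm (y' - y))\<^sup>2)"
    using grad_y_diff by blast
  define \<kappa> where "\<kappa> = C1 + C2 + 1"
  define \<gamma> where "\<gamma> = 1 / (2 * \<kappa>)"
  have \<kappa>: "1 \<le> \<kappa>" "C1 \<le> \<kappa>" "C2 \<le> \<kappa>" using C1 C2 by (auto simp: \<kappa>_def)
  have \<gamma>: "0 < \<gamma>" "\<gamma> \<le> 1 / 2" "\<gamma>\<^sup>2 * \<kappa> = \<gamma> / 2"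
    using \<kappa> by (auto simp: \<gamma>_def field_simps power2_eq_square)
  have "\<gamma> * (f (fst (egce_hat f X I \<gamma> z)) S - 2 * (MAX S\<in>I. f u S))
       \<le> energy u S z - energy u S (egce_update f X I \<gamma> z (egce_hat f X I \<gamma> z))"
    if z: "z \<in> insert 0 X \<times> K" and u: "u \<in> X" and S: "S \<in> I" for z u S
  proof -
    obtain x y where xy: "z = (x, y)" "x \<in> insert 0 X" "y \<in> K" using z by auto
    obtain xh yh where h: "egce_hat f X I \<gamma> z = (xh, yh)" by (cases "egce_hat f X I \<gamma> z")
    obtain xp yp where p: "egce_update f X I \<gamma> z (xh, yh) = (xp, yp)" by (cases "egce_update f X I \<gamma> z (xh, yh)")
    have mem: "xh \<in> X" "yh \<in> K"
      using egce_update_mem[of \<gamma> z z] h unfolding egce_hat_def by auto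
    note cube = K_cube[OF xy(3)] K_cube[OF mem(2)]
    have upd: "egce_update f X I \<gamma> (x, y) (a, b) = (closest_point X (x - \<gamma> *\<^sub>R grad_x a b),
        closest_point K (y - (- \<gamma> *\<^sub>R grad_y a b)))" if "b \<in> cbox 0 1" for a b
      unfolding egce_update_def
      using gradient_multilinear_ext[OF that] gradient_within_multilinear_ext[OF that, of f]
      by (simp add: grad_y_def)
    have xh: "xh = closest_point X (x - \<gamma> *\<^sub>R grad_x x y)"
      and yh: "yh = closest_point K (y - (- \<gamma> *\<^sub>R grad_y x y))"
      using h upd[OF cube(1), of x] by (auto simp: egce_hat_def xy)
    have xp: "xp = closest_point X (x - \<gamma> *\<^sub>R grad_x xh yh)"
      and yp: "yp = closest_point K (y - (- \<gamma> *\<^sub>R grad_y xh yh))"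
      using p upd[OF cube(2), of xh] by (auto simp: xy)
    define dx where "dx = (norm (xh - x))\<^sup>2"
    define dy where "dy = (norm (yh - y))\<^sup>2"
    define E where "E = deficit xh yh"
    have nn: "0 \<le> dx" "0 \<le> dy" "0 \<le> E"
      using deficit_nonneg[OF mem(2)] by (auto simp: dx_def dy_def E_def)
    have ex: "(norm (\<gamma> *\<^sub>R grad_x xh yh - \<gamma> *\<^sub>R grad_x x y))\<^sup>2 \<le> \<gamma> / 2 * (dx + dy + E)"
    proof -
      have "(norm (grad_x xh yh - grad_x x y))\<^sup>2 \<le> C1 * (dx + dy + E)"
        unfolding dx_def dy_def E_def by (rule C1(2)[OF xy(3) mem(2)])
      also have "\<dots> \<le> \<kappa> * (dx + dy + E)" using nn \<kappa> by (intro mult_right_mono) auto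
      finally have "\<gamma>\<^sup>2 * (norm (grad_x xh yh - grad_x x y))\<^sup>2 \<le> \<gamma>\<^sup>2 * \<kappa> * (dx + dy + E)"
        by (simp add: mult.assoc mult_left_mono)
      then show ?thesis
        unfolding \<gamma>(3) scaleR_right_diff_distrib[symmetric] by (simp add: power_mult_distrib)
    qed
    have ey: "(norm (- \<gamma> *\<^sub>R grad_y xh yh - - \<gamma> *\<^sub>R grad_y x y))\<^sup>2 \<le> \<gamma> / 2 * (dx + dy)"
    proof -
      have "(norm (grad_y xh yh - grad_y x y))\<^sup>2 \<le> C2 * (dx + dy)"
        unfolding dx_def dy_def by (rule C2(2)[OF xy(2,3) mem(2)])
      also have "\<dots> \<le> \<kappa> * (dx + dy)" using nn \<kappa> by (intro mult_right_mono) auto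
      finally have "\<gamma>\<^sup>2 * (norm (grad_y xh yh - grad_y x y))\<^sup>2 \<le> \<gamma>\<^sup>2 * \<kappa> * (dx + dy)"
        by (simp add: mult.assoc mult_left_mono)
      then show ?thesis
        unfolding \<gamma>(3) scaleR_right_diff_distrib[symmetric] by (simp add: power_mult_distrib)
    qed
    define gx where "gx = grad_x xh yh \<bullet> (xh - u)"
    define gy where "gy = grad_y xh yh \<bullet> (indicator_vec S - yh)"
    have sx: "2 * (\<gamma> * gx) \<le> (norm (x - u))\<^sup>2 - (norm (xp - u))\<^sup>2 - dx + \<gamma> / 2 * (dx + dy + E)"
      using extragradient_step[OF X(3,2) u, of "\<gamma> *\<^sub>R grad_x xh yh" x "\<gamma> *\<^sub>R grad_x x y", folded xh xp] ex
      by (simp add: dx_def gx_def)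
    have sy: "2 * (\<gamma> * gy) \<le> (norm (y - indicator_vec S))\<^sup>2 - (norm (yp - indicator_vec S))\<^sup>2 - dy + \<gamma> / 2 * (dx + dy)"
      using extragradient_step[OF K_closed_convex(1,2) indicator_vec_in_matroid_polytope[OF S],
          of "- \<gamma> *\<^sub>R grad_y xh yh" y "- \<gamma> *\<^sub>R grad_y x y", folded yh yp] ey
      by (simp add: dy_def gy_def inner_diff_right algebra_simps)
    have "f xh S + E \<le> 2 * subset_mean yh (f xh) + gy"
      unfolding E_def deficit_def gy_def grad_y_def
      by (rule subset_mean_first_order_bound[OF f_submodular f_mono cube(2)])
    also have "subset_mean yh (f xh) \<le> subset_mean yh (f u) + gx"
      using subset_mean_tangent[OF cube(2), of xh u] by (simp add: gx_def inner_diff_right)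
    also have "subset_mean yh (f u) \<le> (MAX S\<in>I. f u S)"
      by (rule subset_mean_le_Max[OF matroid f_mono f_submodular mem(2)])
    finally have "f xh S + E - 2 * (MAX S\<in>I. f u S) \<le> 2 * gx + gy" by simp
    then have "\<gamma> * (f xh S + E - 2 * (MAX S\<in>I. f u S)) \<le> \<gamma> * (2 * gx + gy)"
      using \<gamma> by (intro mult_left_mono) auto
    moreover have "\<gamma> * dx \<le> 1 / 2 * dx" "\<gamma> * dy \<le> 1 / 2 * dy" "0 \<le> \<gamma> * E"
      using mult_right_mono[OF \<gamma>(2) nn(1)] mult_right_mono[OF \<gamma>(2) nn(2)] \<gamma>(1) nn(3) by simp_all
    ultimately have "\<gamma> * f xh S - 2 * (\<gamma> * (MAX S\<in>I. f u S))
        \<le> energy u S (x, y) - energy u S (xp, yp)"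
      using sx sy nn unfolding energy_def fst_conv snd_conv distrib_left right_diff_distrib
        mult.left_commute[of \<gamma> 2] times_divide_eq_left by linarith
    then have "\<gamma> * (f xh S - 2 * (MAX S\<in>I. f u S)) \<le> energy u S (x, y) - energy u S (xp, yp)"
      by (simp add: algebra_simps)
    then show ?thesis using h p xy by simp
  qed
  with \<gamma>(1) show ?thesis by blast
qed

lemma egce_iter_mem: "egce_iter f X I \<gamma> t \<in> insert 0 X \<times> K"
proof (cases t)
  case 0
  have "(0 :: real ^ 'v) = indicator_vec {}" by (simp add: vec_eq_iff)
  then have "(0 :: real ^ 'v) \<in> K" using indicator_vec_in_matroid_polytope[OF empty_indep] by simp
  with 0 show ?thesis by simp
next
  case (Suc n)
  have "egce_iter f X I \<gamma> t \<in> X \<times> K"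
    unfolding Suc egce_iter.simps by (rule egce_update_mem)
  then show ?thesis by auto
qed

lemma egce_output_bound:
  "\<exists>\<gamma>>0. \<exists>D\<ge>0. \<forall>T\<ge>1. \<forall>u\<in>X. \<forall>S\<in>I.
     f (egce_output f X I (\<lambda>_. \<gamma>) T) S / 2 \<le> (MAX S\<in>I. f u S) + D / T"
proof -
  obtain \<gamma> where \<gamma>: "\<gamma> > 0" and step: "\<And>z u S. z \<in> insert 0 X \<times> K \<Longrightarrow> u \<in> X \<Longrightarrow> S \<in> I \<Longrightarrow>
     \<gamma> * (f (fst (egce_hat f X I \<gamma> z)) S - 2 * (MAX S\<in>I. f u S))
       \<le> energy u S z - energy u S (egce_update f X I \<gamma> z (egce_hat f X I \<gamma> z))"
    using egce_energy_decrease by blast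
  obtain r where r: "\<And>x. x \<in> X \<Longrightarrow> norm x \<le> r"
    using X(4) unfolding bounded_iff by blast
  define D where "D = (r\<^sup>2 + (real CARD('v))\<^sup>2 / 2) / (2 * \<gamma>)"
  have "0 \<le> D" using \<gamma> by (simp add: D_def)
  moreover have "f (egce_output f X I (\<lambda>_. \<gamma>) T) S / 2 \<le> (MAX S\<in>I. f u S) + D / T"
    if T: "T \<ge> 1" and u: "u \<in> X" and S: "S \<in> I" for T u S
  proof -
    define it where "it = egce_iter f X I (\<lambda>_. \<gamma>)"
    define xh where "xh t = fst (egce_hat f X I \<gamma> (it (t - 1)))" for t
    define m where "m = (MAX S\<in>I. f u S)"
    have e: "\<gamma> * (f (xh t) S - 2 * m) \<le> energy u S (it (t - 1)) - energy u S (it t)" if "t \<ge> 1" for t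
      using step[OF egce_iter_mem[of "\<lambda>_. \<gamma>" "t - 1"] u S] that
      by (cases t) (auto simp: it_def xh_def m_def)
    have "(\<Sum>t=1..T. \<gamma> * (f (xh t) S - 2 * m)) \<le> energy u S (it 0) - energy u S (it T)"
    proof (induction T)
      case (Suc T)
      then show ?case using e[of "Suc T"] by simp
    qed simp
    also have "\<dots> \<le> energy u S (it 0)"
      using zero_le_power2[of "norm (fst (it T) - u)"] zero_le_power2[of "norm (snd (it T) - indicator_vec S)"]
      unfolding energy_def by linarith
    also have "energy u S (it 0) \<le> r\<^sup>2 + (real CARD('v))\<^sup>2 / 2"
    proof -
      have "norm (indicator_vec S) \<le> (\<Sum>i\<in>UNIV. \<bar>indicator_vec S $ i\<bar>)" by (rule norm_le_l1_cart)
      also have "\<dots> \<le> (\<Sum>i\<in>(UNIV::'v set). 1)" by (intro sum_mono) (simp add: indicator_def)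
      finally have "(norm (indicator_vec S))\<^sup>2 \<le> (real CARD('v))\<^sup>2" by (intro power_mono) auto
      moreover have "(norm u)\<^sup>2 \<le> r\<^sup>2" using r[OF u] by (intro power_mono) auto
      moreover have "energy u S (it 0) = (norm u)\<^sup>2 + (norm (indicator_vec S))\<^sup>2 / 2"
        by (simp add: energy_def it_def)
      ultimately show ?thesis by linarith
    qed
    also have "\<dots> = \<gamma> * (2 * D)" using \<gamma> by (simp add: D_def)
    finally have "(\<Sum>t=1..T. f (xh t) S - 2 * m) \<le> 2 * D"
      using \<gamma> by (simp flip: sum_distrib_left)
    then have avg: "(\<Sum>t=1..T. f (xh t) S) \<le> 2 * D + T * (2 * m)"
      by (simp add: sum_subtractf)
    have "egce_output f X I (\<lambda>_. \<gamma>) T = (\<Sum>t=1..T. (1 / T) *\<^sub>R xh t)"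
      using \<gamma> T unfolding egce_output_def xh_def it_def
      by (simp add: scaleR_sum_right[symmetric] field_simps)
    also have "f \<dots> S \<le> (\<Sum>t=1..T. (1 / T) * f (xh t) S)"
      using T by (intro convex_on_sum[OF _ _ f_convex]) auto
    also have "\<dots> = (\<Sum>t=1..T. f (xh t) S) / T"
      by (simp add: sum_divide_distrib)
    also have "\<dots> \<le> (2 * D + T * (2 * m)) / T"
      using avg by (intro divide_right_mono) auto
    also have "\<dots> = 2 * (m + D / T)" using T by (simp add: field_simps)
    finally show ?thesis
      unfolding m_def by (simp only: pos_divide_le_eq[OF zero_less_numeral] mult.commute)
  qed
  ultimately show ?thesis using \<gamma> by blast
qed

end

theorem theorem7:
  fixes f :: "real ^ 'd \<Rightarrow> 'v::finite set \<Rightarrow> real"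
    and X :: "(real ^ 'd) set"
    and I :: "'v set set"
    and L M :: real
  assumes "X \<noteq> {}" and "closed X" and "convex X" and "bounded X"
    and "matroid I"
    and "\<And>x S. 0 \<le> f x S"
    and "\<And>S. convex_on UNIV (\<lambda>x. f x S)"
    and "\<And>x. mono (f x)"
    and "\<And>x. submodular (f x)"
    and "\<And>x S. (\<lambda>x. f x S) differentiable (at x)"
    and "\<And>x x' S. S \<in> I \<Longrightarrow>
           norm (gradient (\<lambda>x. f x S) x - gradient (\<lambda>x. f x S) x') \<le> L * norm (x - x')"
    and "\<And>x S. norm (gradient (\<lambda>x. f x S) x) \<le> M"
  shows "\<exists>\<gamma>>0. \<exists>C. \<exists>\<epsilon>\<^sub>0>0. \<forall>\<epsilon>. 0 < \<epsilon> \<and> \<epsilon> < \<epsilon>\<^sub>0 \<longrightarrow>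
           (\<exists>T\<ge>1. real T \<le> C / \<epsilon> \<and>
              approx_minimax (1/2) \<epsilon> f X I (egce_output f X I (\<lambda>t. \<gamma>) T))"
proof -
  interpret submodular_saddle f X I "max L 1" M
  proof
    fix x x' :: "real ^ 'd" and S assume "S \<in> I"
    have "L * norm (x - x') \<le> max L 1 * norm (x - x')" by (intro mult_right_mono) auto
    with assms(11)[OF \<open>S \<in> I\<close>, of x x']
    show "norm (gradient (\<lambda>x. f x S) x - gradient (\<lambda>x. f x S) x') \<le> max L 1 * norm (x - x')" by linarith
  qed (use assms in auto)
  obtain \<gamma> D where "\<gamma> > 0" "D \<ge> 0" and bound: "\<And>T u S. T \<ge> 1 \<Longrightarrow> u \<in> X \<Longrightarrow> S \<in> I \<Longrightarrow>
      f (egce_output f X I (\<lambda>_. \<gamma>) T) S / 2 \<le> (MAX S\<in>I. f u S) + D / real T"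
    using egce_output_bound by blast
  have "\<exists>T\<ge>1. real T \<le> (D + 1) / \<epsilon> \<and> approx_minimax (1/2) \<epsilon> f X I (egce_output f X I (\<lambda>t. \<gamma>) T)"
    if \<epsilon>: "0 < \<epsilon>" "\<epsilon> < 1" for \<epsilon>
  proof -
    \<comment> \<open>the largest admissible number of iterations; for \<open>\<epsilon> < 1\<close> it is still at least \<open>D / \<epsilon>\<close>\<close>
    define T where "T = nat \<lfloor>(D + 1) / \<epsilon>\<rfloor>"
    have "1 \<le> (D + 1) / \<epsilon>" using \<epsilon> \<open>D \<ge> 0\<close> by (simp add: field_simps)
    then have T: "T \<ge> 1" "real T \<le> (D + 1) / \<epsilon>" "(D + 1) / \<epsilon> < real T + 1"
      unfolding T_def by linarith+
    have "D / \<epsilon> \<le> real T"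
      using T(3) \<epsilon> by (simp add: field_simps)
    then have "D / real T \<le> \<epsilon>" using T(1) \<epsilon> by (simp add: field_simps)
    let ?x = "egce_output f X I (\<lambda>t. \<gamma>) T"
    have "(MAX S\<in>I. f ?x S) / 2 - \<epsilon> \<le> (INF u\<in>X. MAX S\<in>I. f u S)"
    proof (rule cINF_greatest[OF X(1)])
      fix u assume "u \<in> X"
      have "(MAX S\<in>I. f ?x S) \<in> f ?x ` I"
        using empty_indep by (intro Max_in) auto
      then obtain S where "S \<in> I" "(MAX S\<in>I. f ?x S) = f ?x S" by auto
      with bound[OF T(1) \<open>u \<in> X\<close> this(1)] \<open>D / real T \<le> \<epsilon>\<close>
      show "(MAX S\<in>I. f ?x S) / 2 - \<epsilon> \<le> (MAX S\<in>I. f u S)" by linarith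
    qed
    then have "approx_minimax (1/2) \<epsilon> f X I ?x" by (simp add: approx_minimax_def)
    with T(1,2) show ?thesis by blast
  qed
  with \<open>\<gamma> > 0\<close> show ?thesis
    by (intro exI[of _ \<gamma>] conjI exI[of _ "D + 1"] exI[of _ 1]) auto
qed

end
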